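(* The free group on $2$ generators is a limit of $2$-markings of Thompson's group $F$. That is, there exist a sequence $(S_n)_{n\ge 1}$ of ordered pairs $S_n=(a_n,b_n)$ of elements of $F$, each of which generates $F$, and a free group $L$ of rank $2$ with an ordered generating pair $S$, such that the $2$-marked groups $(F,S_n)$ converge to $(L,S)$ in the space $\mathcal{G}_2$ of isomorphism classes of $2$-marked groups.
   Context: Thompson's group $F$: let $\mathbf{R}_{\ge 0}=\{t\in\mathbf{R}\mid t\ge 0\}$. For each integer $i\ge 0$ let $x_i$ be the self-homeomorphism of $\mathbf{R}_{\ge 0}$, acting on the right, given by $t x_i = t$ if $t\le i$, $t x_i = i+2(t-i)$ if $i\le t\le i+1$, and $t x_i=t+1$ if $t\ge i+1$. Then $F$ is the group of homeomorphisms of $\mathbf{R}_{\ge 0}$ generated by all the $x_i$, $i\ge 0$ (it is generated by $x_0$ and $x_1$). A $k$-marked group is a pair $(G,S)$ where $G$ is a group and $S$ is an ordered $k$-tuple of elements generating $G$ (the $k$-marking). An isomorphism of marked groups is a group isomorphism carrying one marking to the other as ordered tuples. $\mathcal{G}_k$ denotes the set of isomorphism classes of $k$-marked groups. It carries the metric in which two elements are no more than $e^{-R}$ apart if they satisfy the same relations of length no longer than $R$. Here a relation of $(G,S)$ is a reduced word in $k$ letters and their inverses which, when the letters are replaced by the corresponding entries of $S$, represents the trivial element of $G$. Thus $(G_n,S_n)\to (L,S)$ in $\mathcal{G}_k$ if and only if for every $R$ there is $N$ such that for all $n\ge N$ the marked groups $(G_n,S_n)$ and $(L,S)$ satisfy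 exactly the same relations of length at most $R$. *)

theory Defs
  imports "HOL-Algebra.Generated_Groups" "HOL-Analysis.Abstract_Metric_Spaces"
begin

section \<open>Thompson's group\<close>

abbreviation half_line :: "real set" where
  "half_line \<equiv> {0..}"

text \<open>
  Homeomorphisms act on the right, so the product of \<open>f\<close> and \<open>g\<close> sends \<open>t\<close> to \<open>g (f t)\<close>. Elements
  are \<^const>\<open>extensional\<close>, so that equality of elements is equality on the half line.
\<close>

definition homeo_group :: "(real \<Rightarrow> real) monoid" where
  "homeo_group =
     \<lparr>carrier = {f \<in> extensional half_line. \<exists>g. homeomorphism half_line half_line f g},
      mult = (\<lambda>f g. compose half_line g f),
      one = (\<lambda>t\<in>half_line. t)\<rparr>"

definition thompson_gen :: "nat \<Rightarrow> real \<Rightarrow> real" where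
  "thompson_gen i =
     (\<lambda>t\<in>half_line. if t \<le> real i then t
                   else if t \<le> real i + 1 then real i + 2 * (t - real i)
                   else t + 1)"

definition thompson_F :: "(real \<Rightarrow> real) monoid" where
  "thompson_F = homeo_group\<lparr>carrier := generate homeo_group (range thompson_gen)\<rparr>"

lemma homeo_groupI:
  assumes "homeomorphism half_line half_line f g"
  shows "restrict f half_line \<in> carrier homeo_group"
proof -
  have "homeomorphism half_line half_line (restrict f half_line) g"
    using assms by (rule homeomorphism_cong) auto
  then show ?thesis
    by (auto simp: homeo_group_def)
qed

lemma group_homeo_group: "group homeo_group"
proof (rule groupI)
  fix f g assume f: "f \<in> carrier homeo_group" and g: "g \<in> carrier homeo_group"
  then obtain f' g' where "homeomorphism half_line half_line f f'" "homeomorphism half_line half_line g g'"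
    by (auto simp: homeo_group_def)
  then have "homeomorphism half_line half_line (g \<circ> f) (f' \<circ> g')"
    by (rule homeomorphism_compose)
  from homeo_groupI[OF this] show "f \<otimes>\<^bsub>homeo_group\<^esub> g \<in> carrier homeo_group"
    by (simp add: homeo_group_def compose_def o_def)
next
  have "homeomorphism half_line half_line (\<lambda>t. t) (\<lambda>t. t)"
    by (simp add: homeomorphism_def)
  from homeo_groupI[OF this] show "\<one>\<^bsub>homeo_group\<^esub> \<in> carrier homeo_group"
    by (simp add: homeo_group_def)
next
  fix f g h assume "f \<in> carrier homeo_group" "g \<in> carrier homeo_group" "h \<in> carrier homeo_group"
  then have "f ` half_line = half_line"
    by (auto simp: homeo_group_def homeomorphism_def)
  then show "f \<otimes>\<^bsub>homeo_group\<^esub> g \<otimes>\<^bsub>homeo_group\<^esub> h = f \<otimes>\<^bsub>homeo_group\<^esub> (g \<otimes>\<^bsub>homeo_group\<^esub> h)"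
    by (force simp: homeo_group_def compose_def fun_eq_iff restrict_def)
next
  fix f assume f: "f \<in> carrier homeo_group"
  then obtain g where g: "homeomorphism half_line half_line f g" and ext: "f \<in> extensional half_line"
    by (auto simp: homeo_group_def)
  show "\<one>\<^bsub>homeo_group\<^esub> \<otimes>\<^bsub>homeo_group\<^esub> f = f"
    using ext by (auto simp: homeo_group_def compose_def extensional_def fun_eq_iff)
  have "restrict g half_line \<in> carrier homeo_group"
    using homeo_groupI g homeomorphism_sym by blast
  moreover have "restrict g half_line \<otimes>\<^bsub>homeo_group\<^esub> f = \<one>\<^bsub>homeo_group\<^esub>"
    using g by (auto simp: homeo_group_def compose_def homeomorphism_def fun_eq_iff restrict_def)
  ultimately show "\<exists>g\<in>carrier homeo_group. g \<otimes>\<^bsub>homeo_group\<^esub> f = \<one>\<^bsub>homeo_group\<^esub>"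
    by blast
qed

lemma thompson_gen_in_homeo_group: "thompson_gen i \<in> carrier homeo_group"
proof -
  define f :: "real \<Rightarrow> real"
    where "f = (\<lambda>t. max t (min (real i + 2 * (t - real i)) (t + 1)))"
  define g :: "real \<Rightarrow> real"
    where "g = (\<lambda>t. min t (max ((t + real i) / 2) (t - 1)))"
  have f: "f t = (if t \<le> real i then t else if t \<le> real i + 1 then real i + 2 * (t - real i) else t + 1)" for t
    by (auto simp: f_def max_def min_def)
  have g: "g t = (if t \<le> real i then t else if t \<le> real i + 2 then (t + real i) / 2 else t - 1)" for t
    by (auto simp: g_def max_def min_def)
  have "homeomorphism half_line half_line f g"
  proof (rule homeomorphismI)
    show "continuous_on half_line f" "continuous_on half_line g"
      unfolding f_def g_def by (intro continuous_intros; simp)+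
    show "f ` half_line \<subseteq> half_line" "g ` half_line \<subseteq> half_line"
      by (auto simp: f g)
    show "g (f t) = t" "f (g t) = t" if "t \<in> half_line" for t
      by (auto simp: f g add_divide_distrib diff_divide_distrib)
  qed
  from homeo_groupI[OF this] show ?thesis
    by (simp add: thompson_gen_def f[abs_def])
qed

lemma group_thompson_F: "group thompson_F"
proof -
  interpret group homeo_group by (rule group_homeo_group)
  show ?thesis
    unfolding thompson_F_def
    using thompson_gen_in_homeo_group by (intro subgroup_imp_group generate_is_subgroup) auto
qed


section \<open>Words and free groups\<close>

text \<open>The letter \<open>(i, True)\<close> stands for the \<open>i\<close>-th letter, \<open>(i, False)\<close> for its inverse.\<close>

type_synonym word = "(nat \<times> bool) list"

fun inv_letter :: "nat \<times> bool \<Rightarrow> nat \<times> bool" where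
  "inv_letter (i, e) = (i, \<not> e)"

definition words :: "nat \<Rightarrow> word set" where
  "words k = lists ({..<k} \<times> UNIV)"

definition reduced :: "word \<Rightarrow> bool" where
  "reduced w \<longleftrightarrow> successively (\<lambda>x y. y \<noteq> inv_letter x) w"

fun push :: "nat \<times> bool \<Rightarrow> word \<Rightarrow> word" where
  "push x [] = [x]"
| "push x (y # w) = (if y = inv_letter x then w else x # y # w)"

text \<open>
  The free group of rank \<open>k\<close> consists of the reduced words in \<open>k\<close> letters; the product is
  concatenation followed by cancellation.
\<close>

definition free_group :: "nat \<Rightarrow> word monoid" where
  "free_group k = \<lparr>carrier = {w \<in> words k. reduced w}, mult = foldr push, one = []\<rparr>"

definition free_of_rank :: "nat \<Rightarrow> 'a monoid \<Rightarrow> bool" where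
  "free_of_rank k L \<longleftrightarrow> group L \<and> L \<cong> free_group k"

fun letter_val :: "'a monoid \<Rightarrow> 'a list \<Rightarrow> nat \<times> bool \<Rightarrow> 'a" where
  "letter_val G S (i, e) = (if e then S ! i else inv\<^bsub>G\<^esub> (S ! i))"

definition word_val :: "'a monoid \<Rightarrow> 'a list \<Rightarrow> word \<Rightarrow> 'a" where
  "word_val G S w = foldr (\<lambda>x g. letter_val G S x \<otimes>\<^bsub>G\<^esub> g) w \<one>\<^bsub>G\<^esub>"

lemma inv_letter_inv_letter [simp]: "inv_letter (inv_letter x) = x"
  by (cases x) auto

lemma inv_letter_neq [simp]: "inv_letter x \<noteq> x" "x \<noteq> inv_letter x"
  by (cases x; auto)+

lemma inv_letter_inj [simp]: "inv_letter x = inv_letter y \<longleftrightarrow> x = y"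
  by (metis inv_letter_inv_letter)

lemma words_simps [simp]:
  "[] \<in> words k"
  "x # w \<in> words k \<longleftrightarrow> fst x < k \<and> w \<in> words k"
  "v @ w \<in> words k \<longleftrightarrow> v \<in> words k \<and> w \<in> words k"
  "rev w \<in> words k \<longleftrightarrow> w \<in> words k"
  by (cases x; auto simp: words_def)+

lemma fst_inv_letter [simp]: "fst (inv_letter x) = fst x"
  by (cases x) auto

lemma map_inv_letter_words [simp]: "map inv_letter w \<in> words k \<longleftrightarrow> w \<in> words k"
  by (induction w) auto

lemma reduced_Nil [simp]: "reduced []"
  by (simp add: reduced_def)

lemma reduced_Cons:
  "reduced (x # w) \<longleftrightarrow> (w \<noteq> [] \<longrightarrow> hd w \<noteq> inv_letter x) \<and> reduced w"
  by (auto simp: reduced_def successively_Cons)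

lemma push_words: "fst x < k \<Longrightarrow> w \<in> words k \<Longrightarrow> push x w \<in> words k"
  by (cases w) auto

lemma push_reduced: "reduced w \<Longrightarrow> reduced (push x w)"
  by (cases w) (auto simp: reduced_Cons)

lemma push_push_inv: "reduced w \<Longrightarrow> push x (push (inv_letter x) w) = w"
  by (cases w; cases "tl w") (auto simp: reduced_Cons)

lemma foldr_push_words: "v \<in> words k \<Longrightarrow> w \<in> words k \<Longrightarrow> foldr push v w \<in> words k"
  by (induction v) (auto intro: push_words)

lemma foldr_push_reduced: "reduced w \<Longrightarrow> reduced (foldr push v w)"
  by (induction v) (auto intro: push_reduced)

lemma foldr_push_Nil: "reduced w \<Longrightarrow> foldr push w [] = w"
proof (induction w)
  case (Cons x w)
  then show ?case by (cases w) (auto simp: reduced_Cons)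
qed auto

lemma foldr_push_push:
  assumes "reduced w"
  shows "foldr push (push x v) w = push x (foldr push v w)"
  using push_push_inv[OF foldr_push_reduced[OF assms]] by (cases v) auto

lemma foldr_push_assoc:
  assumes "reduced w"
  shows "foldr push (foldr push u v) w = foldr push u (foldr push v w)"
  by (induction u) (auto simp: foldr_push_push assms)

lemma foldr_push_inverse:
  assumes "reduced w"
  shows "foldr push (rev (map inv_letter v)) (foldr push v w) = w"
  using assms
proof (induction v arbitrary: w)
  case (Cons x v)
  show ?case
    using push_push_inv[OF foldr_push_reduced[OF Cons.prems, of v], of "inv_letter x"] Cons
    by simp
qed auto

lemma reduced_rev_inv: "reduced w \<Longrightarrow> reduced (rev (map inv_letter w))"
  unfolding reduced_def successively_rev successively_map
  by (erule successively_mono) auto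

lemma group_free_group: "group (free_group k)"
proof (rule groupI)
  fix w assume "w \<in> carrier (free_group k)"
  then have w: "w \<in> words k" "reduced w" by (auto simp: free_group_def)
  show "\<exists>v\<in>carrier (free_group k). v \<otimes>\<^bsub>free_group k\<^esub> w = \<one>\<^bsub>free_group k\<^esub>"
    using w foldr_push_inverse[of "[]" w]
    by (intro bexI[of _ "rev (map inv_letter w)"])
       (auto simp: free_group_def reduced_rev_inv foldr_push_Nil)
qed (auto simp: free_group_def foldr_push_words foldr_push_reduced foldr_push_assoc)

lemma free_of_rank_free_group: "free_of_rank k (free_group k)"
  by (simp add: free_of_rank_def group_free_group)


section \<open>Marked groups\<close>

type_synonym 'a marked_group = "'a monoid \<times> 'a list"

definition is_marked_group :: "nat \<Rightarrow> 'a marked_group \<Rightarrow> bool" where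
  "is_marked_group k M \<longleftrightarrow>
     group (fst M) \<and> length (snd M) = k \<and> set (snd M) \<subseteq> carrier (fst M) \<and>
     generate (fst M) (set (snd M)) = carrier (fst M)"

definition marked_iso :: "'a marked_group \<Rightarrow> 'b marked_group \<Rightarrow> bool" where
  "marked_iso M N \<longleftrightarrow> (\<exists>h \<in> iso (fst M) (fst N). map h (snd M) = snd N)"

definition relations :: "nat \<Rightarrow> 'a marked_group \<Rightarrow> word set" where
  "relations k M = {w \<in> words k. reduced w \<and> word_val (fst M) (snd M) w = \<one>\<^bsub>fst M\<^esub>}"

definition same_relations_upto :: "nat \<Rightarrow> real \<Rightarrow> 'a marked_group \<Rightarrow> 'b marked_group \<Rightarrow> bool" where
  "same_relations_upto k R M N \<longleftrightarrow>
     {w \<in> relations k M. real (length w) \<le> R} = {w \<in> relations k N. real (length w) \<le> R}"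

text \<open>
  The largest distance that is at most \<open>exp (- R)\<close> whenever the relations of length at most \<open>R\<close>
  coincide: it is \<open>exp (- m)\<close> if the shortest word distinguishing the two has length \<open>m\<close>, and \<open>0\<close>
  if there is no such word.
\<close>

definition relation_dist :: "nat \<Rightarrow> 'a marked_group \<Rightarrow> 'b marked_group \<Rightarrow> real" where
  "relation_dist k M N = Inf {exp (- R) | R. same_relations_upto k R M N}"

text \<open>
  Finitely generated groups are countable, so the isomorphism classes can be formed from groups
  whose carrier is a set of natural numbers; \<open>marked_class_in_space\<close> and \<open>marked_class_eq_iff\<close>
  below show that nothing is lost for marked groups over other types.
\<close>

definition marked_class :: "nat \<Rightarrow> 'a marked_group \<Rightarrow> nat marked_group set" where
  "marked_class k M = {N. is_marked_group k N \<and> marked_iso M N}"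

definition marked_space :: "nat \<Rightarrow> nat marked_group set set" where
  "marked_space k = {marked_class k M | M :: nat marked_group. is_marked_group k M}"

definition marked_dist :: "nat \<Rightarrow> nat marked_group set \<Rightarrow> nat marked_group set \<Rightarrow> real" where
  "marked_dist k C D = relation_dist k (SOME M. M \<in> C) (SOME N. N \<in> D)"

definition marked_topology :: "nat \<Rightarrow> nat marked_group set topology" where
  "marked_topology k = Metric_space.mtopology (marked_space k) (marked_dist k)"


subsection \<open>Values of words\<close>

context
  fixes k :: nat and G :: "'a monoid" and S :: "'a list"
  assumes marked: "is_marked_group k (G, S)"
begin

interpretation group G
  using marked by (simp add: is_marked_group_def)

lemma marking_in_carrier: "i < k \<Longrightarrow> S ! i \<in> carrier G"
  using marked by (auto simp: is_marked_group_def)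

lemma letter_val_closed: "fst x < k \<Longrightarrow> letter_val G S x \<in> carrier G"
  by (cases x) (auto simp: marking_in_carrier)

lemma letter_val_inv: "fst x < k \<Longrightarrow> letter_val G S (inv_letter x) = inv\<^bsub>G\<^esub> (letter_val G S x)"
  by (cases x) (auto simp: marking_in_carrier)

lemma word_val_Nil [simp]: "word_val G S [] = \<one>\<^bsub>G\<^esub>"
  by (simp add: word_val_def)

lemma word_val_Cons [simp]: "word_val G S (x # w) = letter_val G S x \<otimes>\<^bsub>G\<^esub> word_val G S w"
  by (simp add: word_val_def)

lemma word_val_closed: "w \<in> words k \<Longrightarrow> word_val G S w \<in> carrier G"
  by (induction w) (auto simp: letter_val_closed)

lemma word_val_append:
  "v \<in> words k \<Longrightarrow> w \<in> words k \<Longrightarrow> word_val G S (v @ w) = word_val G S v \<otimes>\<^bsub>G\<^esub> word_val G S w"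
  by (induction v) (auto simp: letter_val_closed word_val_closed m_assoc)

lemma word_val_inverse:
  "w \<in> words k \<Longrightarrow> word_val G S (rev (map inv_letter w)) = inv\<^bsub>G\<^esub> (word_val G S w)"
  by (induction w)
     (auto simp: word_val_append letter_val_inv letter_val_closed word_val_closed inv_mult_group)

lemma word_val_push:
  assumes "fst x < k" "w \<in> words k"
  shows "word_val G S (push x w) = letter_val G S x \<otimes>\<^bsub>G\<^esub> word_val G S w"
proof (cases "\<exists>v. w = inv_letter x # v")
  case True
  then obtain v where v: "w = inv_letter x # v" by blast
  have *: "letter_val G S x \<in> carrier G" "word_val G S v \<in> carrier G"
    using assms v by (auto intro: letter_val_closed word_val_closed)
  then show ?thesis
    using m_assoc[OF *(1) inv_closed[OF *(1)] *(2)] assms(1) v by (simp add: letter_val_inv)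
next
  case False
  then show ?thesis by (cases w) auto
qed

lemma word_val_reduce:
  "w \<in> words k \<Longrightarrow> word_val G S (foldr push w []) = word_val G S w"
  by (induction w) (auto simp: word_val_push foldr_push_words)

lemma word_val_eq_iff:
  assumes "v \<in> words k" "w \<in> words k"
  shows "word_val G S v = word_val G S w \<longleftrightarrow>
         foldr push (v @ rev (map inv_letter w)) [] \<in> relations k (G, S)"
proof -
  have "word_val G S (foldr push (v @ rev (map inv_letter w)) []) =
        word_val G S v \<otimes>\<^bsub>G\<^esub> inv\<^bsub>G\<^esub> (word_val G S w)"
    using assms by (simp add: word_val_reduce word_val_append word_val_inverse del: foldr_append)
  moreover have "foldr push (v @ rev (map inv_letter w)) [] \<in> words k"
    using assms by (intro foldr_push_words) auto
  moreover have "reduced (foldr push (v @ rev (map inv_letter w)) [])"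
    by (intro foldr_push_reduced) auto
  moreover have "word_val G S v \<otimes>\<^bsub>G\<^esub> inv\<^bsub>G\<^esub> (word_val G S w) = \<one>\<^bsub>G\<^esub>
                 \<longleftrightarrow> word_val G S v = word_val G S w"
    using word_val_closed[OF assms(1)] word_val_closed[OF assms(2)]
    by (metis inv_equality inv_inv inv_closed r_inv)
  ultimately show ?thesis
    by (simp add: relations_def del: foldr_append)
qed

lemma word_val_surj: "word_val G S ` words k = carrier G"
proof
  show "word_val G S ` words k \<subseteq> carrier G"
    by (auto simp: word_val_closed)
  have len: "length S = k" and gen: "generate G (set S) = carrier G"
    using marked by (auto simp: is_marked_group_def)
  have "\<exists>w\<in>words k. g = word_val G S w" if "g \<in> generate G (set S)" for g
    using that
  proof induction
    case one
    have "\<one>\<^bsub>G\<^esub> = word_val G S []" by simp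
    then show ?case by (metis words_simps(1))
  next
    case (incl h)
    then obtain i where i: "i < k" "h = S ! i"
      unfolding in_set_conv_nth len by blast
    then have "h = word_val G S [(i, True)]"
      by (simp add: marking_in_carrier)
    moreover have "[(i, True)] \<in> words k" using i by simp
    ultimately show ?case by blast
  next
    case (inv h)
    then obtain i where i: "i < k" "h = S ! i"
      unfolding in_set_conv_nth len by blast
    then have "inv\<^bsub>G\<^esub> h = word_val G S [(i, False)]"
      by (simp add: marking_in_carrier)
    moreover have "[(i, False)] \<in> words k" using i by simp
    ultimately show ?case by blast
  next
    case (eng g h)
    then obtain v w where vw: "v \<in> words k" "w \<in> words k" "g = word_val G S v" "h = word_val G S w"
      by blast
    then have "g \<otimes>\<^bsub>G\<^esub> h = word_val G S (v @ w)" "v @ w \<in> words k"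
      by (simp_all add: word_val_append)
    then show ?case by blast
  qed
  then show "carrier G \<subseteq> word_val G S ` words k"
    unfolding gen by blast
qed

end


subsection \<open>Isomorphism of marked groups\<close>

lemma word_val_iso:
  assumes M: "is_marked_group k (G, S)" and N: "is_marked_group k (H, T)"
    and h: "h \<in> iso G H" and T: "map h S = T" and w: "w \<in> words k"
  shows "h (word_val G S w) = word_val H T w"
proof -
  interpret group_hom G H h
    using M N h by (auto simp: is_marked_group_def group_hom_def group_hom_axioms_def iso_def)
  have [simp]: "h (S ! i) = T ! i" if "i < k" for i
    using that M T by (auto simp: is_marked_group_def)
  have "h (letter_val G S x) = letter_val H T x" if "fst x < k" for x
    using that by (cases x) (auto simp: marking_in_carrier[OF M])
  then show ?thesis
    using w by (induction w)
      (auto simp: word_val_def letter_val_closed[OF M]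
        word_val_closed[OF M, unfolded word_val_def])
qed

lemma marked_iso_relations:
  assumes M: "is_marked_group k M" and N: "is_marked_group k N" and "marked_iso M N"
  shows "relations k M = relations k N"
proof -
  obtain G S H T where [simp]: "M = (G, S)" "N = (H, T)" by fastforce
  obtain h where h: "h \<in> iso G H" "map h S = T"
    using assms(3) by (auto simp: marked_iso_def)
  interpret group_hom G H h
    using M N h by (auto simp: is_marked_group_def group_hom_def group_hom_axioms_def iso_def)
  have inj: "inj_on h (carrier G)"
    using h by (auto simp: iso_def bij_betw_def)
  have "word_val G S w = \<one>\<^bsub>G\<^esub> \<longleftrightarrow> word_val H T w = \<one>\<^bsub>H\<^esub>" if "w \<in> words k" for w
    using word_val_iso[OF M[simplified] N[simplified] h that]
      word_val_closed[OF M[simplified] that] inj_onD[OF inj] by (metis G.one_closed hom_one)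
  then show ?thesis
    by (auto simp: relations_def)
qed

lemma relations_marked_iso:
  assumes M: "is_marked_group k M" and N: "is_marked_group k N"
    and eq: "relations k M = relations k N"
  shows "marked_iso M N"
proof -
  obtain G S H T where [simp]: "M = (G, S)" "N = (H, T)" by fastforce
  note M = M[simplified] and N = N[simplified]
  interpret G: group G using M by (simp add: is_marked_group_def)
  interpret H: group H using N by (simp add: is_marked_group_def)
  have iff: "word_val G S v = word_val G S w \<longleftrightarrow> word_val H T v = word_val H T w"
    if "v \<in> words k" "w \<in> words k" for v w
    using word_val_eq_iff[OF M that] word_val_eq_iff[OF N that] eq by simp
  define h where "h = (\<lambda>g. word_val H T (SOME w. w \<in> words k \<and> word_val G S w = g))"
  have h: "h (word_val G S w) = word_val H T w" if "w \<in> words k" for w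
  proof -
    have "\<exists>v. v \<in> words k \<and> word_val G S v = word_val G S w"
      using that by blast
    from someI_ex[OF this] show ?thesis
      unfolding h_def using iff that by blast
  qed
  have G: "\<exists>w\<in>words k. g = word_val G S w" if "g \<in> carrier G" for g
    using that word_val_surj[OF M] by blast
  have "h \<in> iso G H"
  proof (rule isoI)
    show "h \<in> hom G H"
    proof (rule homI)
      fix x y assume "x \<in> carrier G" "y \<in> carrier G"
      then obtain v w where vw: "v \<in> words k" "w \<in> words k" "x = word_val G S v" "y = word_val G S w"
        using G by meson
      then show "h (x \<otimes>\<^bsub>G\<^esub> y) = h x \<otimes>\<^bsub>H\<^esub> h y"
        by (simp add: word_val_append[OF M, symmetric] h word_val_append[OF N])
    qed (use G h word_val_closed[OF N] in force)
    show "bij_betw h (carrier G) (carrier H)"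
      unfolding bij_betw_def
    proof
      show "inj_on h (carrier G)"
        by (rule inj_onI) (metis G h iff)
      show "h ` carrier G = carrier H"
        unfolding word_val_surj[OF M, symmetric] word_val_surj[OF N, symmetric] image_image
        by (rule image_cong) (auto simp: h)
    qed
  qed
  moreover have "map h S = T"
  proof (rule nth_equalityI)
    show "length (map h S) = length T"
      using M N by (simp add: is_marked_group_def)
    fix i assume "i < length (map h S)"
    then have i: "i < k" using M by (simp add: is_marked_group_def)
    have "h (word_val G S [(i, True)]) = word_val H T [(i, True)]"
      using i by (intro h) auto
    then show "map h S ! i = T ! i"
      using i M N
      by (simp add: word_val_def marking_in_carrier[OF M] marking_in_carrier[OF N] is_marked_group_def)
  qed
  ultimately show ?thesis
    by (auto simp: marked_iso_def)
qed

lemma marked_iso_iff_relations: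
  assumes "is_marked_group k M" "is_marked_group k N"
  shows "marked_iso M N \<longleftrightarrow> relations k M = relations k N"
  using assms marked_iso_relations relations_marked_iso by blast

lemma ex_nat_marked_group:
  assumes M: "is_marked_group k M"
  shows "\<exists>N :: nat marked_group. is_marked_group k N \<and> marked_iso M N"
proof -
  obtain G S where [simp]: "M = (G, S)" by fastforce
  note M = M[simplified]
  interpret G: group G using M by (simp add: is_marked_group_def)
  have "countable (carrier G)"
    unfolding word_val_surj[OF M, symmetric] by (intro countable_image countableI_type)
  then obtain f :: "'a \<Rightarrow> nat" where inj: "inj_on f (carrier G)"
    by (auto simp: countable_def)
  define f' where "f' = inv_into (carrier G) f"
  have [simp]: "f' (f x) = x" if "x \<in> carrier G" for x
    using inj that by (simp add: f'_def)
  define H :: "nat monoid" where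
    "H = \<lparr>carrier = f ` carrier G, mult = (\<lambda>x y. f (f' x \<otimes>\<^bsub>G\<^esub> f' y)), one = f \<one>\<^bsub>G\<^esub>\<rparr>"
  have "group H"
  proof (rule groupI)
    fix x assume "x \<in> carrier H"
    then obtain g where g: "g \<in> carrier G" "x = f g" by (auto simp: H_def)
    then show "\<exists>y\<in>carrier H. y \<otimes>\<^bsub>H\<^esub> x = \<one>\<^bsub>H\<^esub>"
      by (intro bexI[of _ "f (inv\<^bsub>G\<^esub> g)"]) (auto simp: H_def)
  qed (auto simp: H_def G.m_assoc)
  moreover have f: "f \<in> iso G H"
    using inj by (auto simp: iso_def hom_def bij_betw_def H_def)
  moreover have "generate H (f ` set S) = f ` generate G (set S)"
  proof -
    interpret group_hom G H f
      using \<open>group H\<close> f by (auto simp: group_hom_def group_hom_axioms_def iso_def)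
    show ?thesis
      using M by (intro generate_img) (auto simp: is_marked_group_def)
  qed
  ultimately have "is_marked_group k (H, map f S)"
    using M by (auto simp: is_marked_group_def H_def)
  moreover have "marked_iso M (H, map f S)"
    using f by (auto simp: marked_iso_def)
  ultimately show ?thesis by blast
qed

lemma relations_some_marked_class:
  assumes "is_marked_group k M"
  shows "relations k (SOME N. N \<in> marked_class k M) = relations k M"
proof -
  have "\<exists>N. N \<in> marked_class k M"
    using ex_nat_marked_group[OF assms] by (auto simp: marked_class_def)
  from someI_ex[OF this] have "(SOME N. N \<in> marked_class k M) \<in> marked_class k M" .
  then have "is_marked_group k (SOME N. N \<in> marked_class k M)"
    "marked_iso M (SOME N. N \<in> marked_class k M)"
    unfolding marked_class_def by blast+
  from marked_iso_relations[OF assms this] show ?thesis ..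
qed

lemma marked_class_eq_iff:
  fixes M :: "'a marked_group" and N :: "'b marked_group"
  assumes "is_marked_group k M" "is_marked_group k N"
  shows "marked_class k M = marked_class k N \<longleftrightarrow> marked_iso M N"
proof
  assume "marked_class k M = marked_class k N"
  then show "marked_iso M N"
    using assms by (metis marked_iso_iff_relations relations_some_marked_class)
next
  assume "marked_iso M N"
  then have "relations k M = relations k N"
    using assms by (simp add: marked_iso_iff_relations)
  then show "marked_class k M = marked_class k N"
    unfolding marked_class_def
    by (intro Collect_cong) (metis assms marked_iso_iff_relations)
qed

lemma marked_class_in_space:
  fixes M :: "'a marked_group"
  assumes "is_marked_group k M"
  shows "marked_class k M \<in> marked_space k"
proof -
  obtain N :: "nat marked_group" where "is_marked_group k N" "marked_iso M N"
    using ex_nat_marked_group[OF assms] by blast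
  then show ?thesis
    using marked_class_eq_iff[OF assms] unfolding marked_space_def by blast
qed


subsection \<open>The metric\<close>

lemma same_relations_upto_mono:
  "same_relations_upto k R M N \<Longrightarrow> R' \<le> R \<Longrightarrow> same_relations_upto k R' M N"
  unfolding same_relations_upto_def set_eq_iff by fastforce

lemma same_relations_upto_commute:
  "same_relations_upto k R M N \<longleftrightarrow> same_relations_upto k R N M"
  unfolding same_relations_upto_def by auto

lemma relation_dist_set_nonempty: "{exp (- R) | R. same_relations_upto k R M N} \<noteq> {}"
proof -
  have "same_relations_upto k (-1) M N"
    by (auto simp: same_relations_upto_def)
  then show ?thesis by blast
qed

lemma relation_dist_set_bdd_below: "bdd_below {exp (- R :: real) | R. same_relations_upto k R M N}"
  by (rule bdd_belowI[of _ 0]) auto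

lemma relation_dist_less_iff:
  "relation_dist k M N < e \<longleftrightarrow> (\<exists>R. same_relations_upto k R M N \<and> exp (- R) < e)"
  unfolding relation_dist_def
    cInf_less_iff[OF relation_dist_set_nonempty relation_dist_set_bdd_below] by blast

lemma exp_minus_less:
  assumes "(e :: real) > 0"
  shows "exp (- (1 - ln e)) < e"
proof -
  have "exp (- (1 - ln e)) < exp (ln e)" by (subst exp_less_cancel_iff) simp
  then show ?thesis using assms by simp
qed

lemma relation_dist_le: "same_relations_upto k R M N \<Longrightarrow> relation_dist k M N \<le> exp (- R)"
  unfolding relation_dist_def by (rule cInf_lower[OF _ relation_dist_set_bdd_below]) blast

lemma relation_dist_nonneg: "0 \<le> relation_dist k M N"
  unfolding relation_dist_def by (rule cInf_greatest[OF relation_dist_set_nonempty]) auto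

lemma relation_dist_commute: "relation_dist k M N = relation_dist k N M"
  unfolding relation_dist_def using same_relations_upto_commute by metis

lemma relation_dist_less_imp:
  assumes "relation_dist k M N < exp (- R)"
  shows "same_relations_upto k R M N"
proof -
  obtain R' where "same_relations_upto k R' M N" "exp (- R') < exp (- R)"
    using assms relation_dist_less_iff by blast
  then show ?thesis
    using same_relations_upto_mono by fastforce
qed

lemma relation_dist_eq_0_iff: "relation_dist k M N = 0 \<longleftrightarrow> relations k M = relations k N"
proof
  assume 0: "relation_dist k M N = 0"
  have "w \<in> relations k M \<longleftrightarrow> w \<in> relations k N" for w
    using relation_dist_less_imp[of k M N "real (length w)"] 0
    by (auto simp: same_relations_upto_def)
  then show "relations k M = relations k N" by blast
next
  assume "relations k M = relations k N"
  then have "same_relations_upto k R M N" for R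
    by (simp add: same_relations_upto_def)
  then have "relation_dist k M N < e" if "e > 0" for e
    unfolding relation_dist_less_iff using exp_minus_less[OF that] by blast
  then show "relation_dist k M N = 0"
    using relation_dist_nonneg[of k M N] by (metis less_irrefl order_le_less)
qed

lemma relation_dist_ultra:
  "relation_dist k M P \<le> max (relation_dist k M N) (relation_dist k N P)"
proof (rule dense_ge)
  fix e assume "max (relation_dist k M N) (relation_dist k N P) < e"
  then have "relation_dist k M N < e" "relation_dist k N P < e" by simp_all
  then obtain R R' where R: "same_relations_upto k R M N" "exp (- R) < e"
    and R': "same_relations_upto k R' N P" "exp (- R') < e"
    unfolding relation_dist_less_iff by blast
  have "same_relations_upto k (min R R') M N"
    by (rule same_relations_upto_mono[OF R(1)]) simp
  moreover have "same_relations_upto k (min R R') N P"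
    by (rule same_relations_upto_mono[OF R'(1)]) simp
  ultimately have "same_relations_upto k (min R R') M P"
    unfolding same_relations_upto_def by (rule trans)
  then have "relation_dist k M P \<le> exp (- min R R')"
    by (rule relation_dist_le)
  also have "exp (- min R R') < e"
    using R(2) R'(2) by (simp add: min_def)
  finally show "relation_dist k M P \<le> e" by simp
qed

lemma marked_dist_class:
  assumes "is_marked_group k M" "is_marked_group k N"
  shows "marked_dist k (marked_class k M) (marked_class k N) = relation_dist k M N"
  unfolding marked_dist_def relation_dist_def same_relations_upto_def
    relations_some_marked_class[OF assms(1)] relations_some_marked_class[OF assms(2)] ..

lemma Metric_space_marked_space: "Metric_space (marked_space k) (marked_dist k)"
proof
  fix C D E
  show "0 \<le> marked_dist k C D"
    by (simp add: marked_dist_def relation_dist_nonneg)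
  show "marked_dist k C D = marked_dist k D C"
    unfolding marked_dist_def by (rule relation_dist_commute)
  show "marked_dist k C D = 0 \<longleftrightarrow> C = D" if CD: "C \<in> marked_space k" "D \<in> marked_space k"
  proof -
    obtain M N :: "nat marked_group" where M: "is_marked_group k M" "C = marked_class k M"
      and N: "is_marked_group k N" "D = marked_class k N"
      using CD unfolding marked_space_def by blast
    show ?thesis
      unfolding M(2) N(2) marked_dist_class[OF M(1) N(1)] marked_class_eq_iff[OF M(1) N(1)]
      by (simp only: relation_dist_eq_0_iff marked_iso_iff_relations[OF M(1) N(1)])
  qed
  show "marked_dist k C E \<le> marked_dist k C D + marked_dist k D E"
  proof -
    have "relation_dist k M P \<le> relation_dist k M N + relation_dist k N P"
      for M N P :: "nat marked_group"
      using relation_dist_ultra[of k M P N] relation_dist_nonneg[of k M N]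
        relation_dist_nonneg[of k N P] by linarith
    then show ?thesis unfolding marked_dist_def .
  qed
qed

lemma limitin_marked_topology_iff:
  fixes M :: "nat \<Rightarrow> 'a marked_group" and L :: "'b marked_group"
  assumes L: "is_marked_group k L" and M: "\<forall>\<^sub>F n in sequentially. is_marked_group k (M n)"
  shows "limitin (marked_topology k) (\<lambda>n. marked_class k (M n)) (marked_class k L) sequentially
     \<longleftrightarrow> (\<forall>R. \<exists>N. \<forall>n\<ge>N. same_relations_upto k R (M n) L)"
proof -
  interpret Metric_space "marked_space k" "marked_dist k"
    by (rule Metric_space_marked_space)
  have *: "(\<forall>\<^sub>F n in sequentially. marked_class k (M n) \<in> marked_space k \<and>
              marked_dist k (marked_class k (M n)) (marked_class k L) < e)
     \<longleftrightarrow> (\<forall>\<^sub>F n in sequentially. relation_dist k (M n) L < e)" for e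
    using M by (intro eventually_cong[OF M]) (auto simp: marked_class_in_space marked_dist_class L)
  have "(\<forall>e>0. \<forall>\<^sub>F n in sequentially. relation_dist k (M n) L < e)
     \<longleftrightarrow> (\<forall>R. \<forall>\<^sub>F n in sequentially. same_relations_upto k R (M n) L)"
  proof (intro iffI allI impI)
    fix R :: real
    assume "\<forall>e>0. \<forall>\<^sub>F n in sequentially. relation_dist k (M n) L < e"
    then have "\<forall>\<^sub>F n in sequentially. relation_dist k (M n) L < exp (- R)" by simp
    then show "\<forall>\<^sub>F n in sequentially. same_relations_upto k R (M n) L"
      by eventually_elim (rule relation_dist_less_imp)
  next
    fix e :: real
    assume e: "e > 0" and "\<forall>R. \<forall>\<^sub>F n in sequentially. same_relations_upto k R (M n) L"
    then have "\<forall>\<^sub>F n in sequentially. same_relations_upto k (1 - ln e) (M n) L" by blast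
    then show "\<forall>\<^sub>F n in sequentially. relation_dist k (M n) L < e"
      by eventually_elim (use exp_minus_less[OF e] relation_dist_less_iff in blast)
  qed
  then show ?thesis
    unfolding marked_topology_def limitin_metric *
    using marked_class_in_space[OF L] by (simp add: eventually_sequentially)
qed

end

theory Submission
  imports Defs
begin

text \<open>
  Write \<open>x\<^sub>i\<close> for the generators of Thompson's group \<open>F\<close>; the only relations that matter are
  \<open>x\<^sub>j x\<^sub>i = x\<^sub>i x\<^sub>j\<^sub>+\<^sub>1\<close> for \<open>i < j\<close>. The limit is free as soon as, for each \<open>R\<close>, some \<open>b\<close> generates
  \<open>F\<close> together with \<open>x\<^sub>0\<close> while no nonempty reduced word of length at most \<open>R\<close> in \<open>x\<^sub>0\<close> and \<open>b\<close>
  is trivial. Far out on the half line \<open>x\<^sub>0\<close> is the translation by one, so \<open>b\<close> can be given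
  independent tasks on disjoint stretches: it is a product of a middle part \<open>f\<close> that destroys
  short relations, of two copies of a fixed element placed on both sides of \<open>f\<close>, and of some \<open>x\<^sub>M\<close>
  acting far to the right of all of them.

  Generation (\<open>generating_pair\<close>). Let \<open>b = \<beta> x\<^sub>M\<close> where \<open>\<beta> = d\<^sub>1 f d\<^sub>n\<close> has compact support and
  \<open>d\<^sub>i = x\<^sub>i x\<^sub>i\<^sub>+\<^sub>2\<inverse>\<close>. Conjugation by \<open>x\<^sub>0\<close> is a shift, so the subgroup generated by \<open>x\<^sub>0\<close> and \<open>b\<close>
  contains all shifts of \<open>b\<close>. Conjugating the \<open>N\<close>-th shift twice by \<open>b\<close> turns its tail into that of
  the shift by \<open>N + 2\<close>, and their quotient \<open>\<beta>\<^sub>N \<beta>\<^sub>N\<^sub>+\<^sub>2\<inverse>\<close> has no tail, where \<open>\<beta>\<^sub>k\<close> is the shift of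
  \<open>\<beta>\<close> by \<open>k\<close> (\<open>tail_elimination\<close>). The shifts are chosen so that a commutator of
  this element with a shift of \<open>b\<close> only sees the right end of one copy of \<open>\<beta>\<close> and the left end of
  another. The ends \<open>d\<^sub>i\<close> are such that this commutator is \<open>x\<^sub>i\<^sub>+\<^sub>1 x\<^sub>i\<^sub>+\<^sub>2\<inverse>\<close> for some \<open>i\<close>. Its conjugates
  under \<open>x\<^sub>0\<close> generate a group containing \<open>\<beta>\<close>, whatever \<open>f\<close> was, hence \<open>x\<^sub>M\<close> and all the \<open>x\<^sub>i\<close>
  are obtained.

  Freeness (\<open>ex_realizing_element\<close>). All short reduced words occur inside a single reduced word
  \<open>v\<close>, so it is enough that along the path of a suitable point under \<open>v\<close> no nonempty subword returns
  to where it started. The path is prescribed: its points are \<open>p + 3 / 2\<^bsup>j + 3\<^esup>\<close>, where \<open>p\<close> changes by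
  one with each letter \<open>x\<^sub>0\<close> and \<open>j\<close> increases by one with each letter \<open>b\<close>, of either sign.
  Since \<open>v\<close> is reduced, the values of \<open>f\<close> that this prescribes are consistent, and \<open>f\<close> can be built
  one letter at a time from elements that move a single grid point to the next one. A subword along
  which neither \<open>p\<close> nor \<open>j\<close> changes in total has no letter \<open>b\<close> and is a power of \<open>x\<^sub>0\<close> with exponent
  zero, so it is empty.
\<close>


section \<open>Commuting elements and commutators\<close>

context group
begin

lemma cancel_inv_left [simp]:
  "g \<in> carrier G \<Longrightarrow> h \<in> carrier G \<Longrightarrow> inv g \<otimes> (g \<otimes> h) = h"
  "g \<in> carrier G \<Longrightarrow> h \<in> carrier G \<Longrightarrow> g \<otimes> (inv g \<otimes> h) = h"
  by (simp_all add: m_assoc[symmetric])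

lemma intertwine_inv_left:
  assumes "g \<otimes> h = h \<otimes> k" "g \<in> carrier G" "h \<in> carrier G" "k \<in> carrier G"
  shows "inv h \<otimes> g = k \<otimes> inv h"
proof -
  have "inv h \<otimes> g = inv h \<otimes> (g \<otimes> h) \<otimes> inv h"
    using assms(2-) by (simp add: m_assoc)
  then show ?thesis
    using assms by (simp add: m_assoc)
qed

lemma intertwine_inv_right:
  assumes "g \<otimes> h = h \<otimes> k" "g \<in> carrier G" "h \<in> carrier G" "k \<in> carrier G"
  shows "inv g \<otimes> h = h \<otimes> inv k"
proof -
  have "inv g \<otimes> h = inv g \<otimes> (h \<otimes> k) \<otimes> inv k"
    using assms(2-) by (simp add: m_assoc)
  then show ?thesis
    using assms(2-) by (simp add: assms(1)[symmetric] m_assoc)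
qed

lemma commute_inv:
  assumes "g \<otimes> h = h \<otimes> g" "g \<in> carrier G" "h \<in> carrier G"
  shows "inv g \<otimes> h = h \<otimes> inv g"
  using intertwine_inv_right[of g h g] assms by simp

lemma commute_mult:
  assumes "g \<otimes> k = k \<otimes> g" "h \<otimes> k = k \<otimes> h" "g \<in> carrier G" "h \<in> carrier G" "k \<in> carrier G"
  shows "g \<otimes> h \<otimes> k = k \<otimes> (g \<otimes> h)"
  using assms by (metis m_assoc)

lemma generate_commute:
  assumes "\<And>s. s \<in> S \<Longrightarrow> s \<otimes> h = h \<otimes> s" "S \<subseteq> carrier G" "h \<in> carrier G" "g \<in> generate G S"
  shows "g \<otimes> h = h \<otimes> g"
  using assms(4)
proof induction
  case (inv s)
  then show ?case using assms by (intro commute_inv) auto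
next
  case (eng g g')
  then show ?case
    using assms by (intro commute_mult) (auto intro: generate_in_carrier)
qed (use assms in auto)

text \<open>
  The commutator of \<open>g\<close> with the inverse of \<open>h\<close>; with these signs the identity for double bumps
  below has no inverses on either side.
\<close>

definition commutator :: "'a \<Rightarrow> 'a \<Rightarrow> 'a" where
  "commutator g h = g \<otimes> inv h \<otimes> inv g \<otimes> h"

text \<open>
  The two absorption rules isolate the parts of two elements that really interact: \<open>k\<close> and its
  inverse meet after passing over \<open>inv h\<close>, or over \<open>inv g\<close> respectively.
\<close>

lemma commutator_absorb_left:
  assumes "k \<otimes> h = h \<otimes> k" "g \<in> carrier G" "h \<in> carrier G" "k \<in> carrier G"
  shows "commutator (g \<otimes> k) h = commutator g h"
proof -
  have "k \<otimes> inv h \<otimes> inv k = inv h \<otimes> k \<otimes> inv k"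
    using intertwine_inv_left[of k h k] assms by simp
  then have "k \<otimes> inv h \<otimes> inv k = inv h"
    using assms(2-) by (simp add: m_assoc)
  then have "g \<otimes> (k \<otimes> inv h \<otimes> inv k) \<otimes> inv g \<otimes> h = commutator g h"
    by (simp add: commutator_def)
  then show ?thesis
    using assms(2-) by (simp add: commutator_def inv_mult_group m_assoc)
qed

lemma commutator_absorb_right:
  assumes "k \<otimes> g = g \<otimes> k" "g \<in> carrier G" "h \<in> carrier G" "k \<in> carrier G"
  shows "commutator g (k \<otimes> h) = commutator g h"
proof -
  have "inv k \<otimes> inv g \<otimes> k = inv k \<otimes> (k \<otimes> inv g)"
    using intertwine_inv_left[of k g k] assms by (simp add: m_assoc)
  then have "inv k \<otimes> inv g \<otimes> k = inv g"
    using assms(2-) by simp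
  then have "g \<otimes> inv h \<otimes> (inv k \<otimes> inv g \<otimes> k) \<otimes> h = commutator g h"
    by (simp add: commutator_def)
  then show ?thesis
    using assms(2-) by (simp add: commutator_def inv_mult_group m_assoc)
qed

end

section \<open>Consequences of the Thompson relations\<close>

locale thompson_relations = group G for G (structure) +
  fixes x :: "nat \<Rightarrow> 'a"
  assumes x_closed [simp, intro]: "x i \<in> carrier G"
    and x_relation: "i < j \<Longrightarrow> x j \<otimes> x i = x i \<otimes> x (Suc j)"
begin

text \<open>
  In Thompson's group this is a bump with support \<open>(i, i + 2)\<close>; by the relations, for positive
  \<open>i\<close>, conjugation by \<open>x 0\<close> raises its index by one.
\<close>

definition bump :: "nat \<Rightarrow> 'a" where "bump i = x i \<otimes> inv (x (Suc i))"

definition double_bump :: "nat \<Rightarrow> 'a" where "double_bump i = x i \<otimes> inv (x (i + 2))"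

text \<open>
  An algebraic substitute for the elements with support in \<open>(p, q + 1)\<close>: each generator \<open>bump i\<close>
  with \<open>p \<le> i < q\<close> has its support there.
\<close>

definition bump_group :: "nat \<Rightarrow> nat \<Rightarrow> 'a set" where "bump_group p q = generate G (bump ` {p..<q})"

definition shift :: "'a \<Rightarrow> 'a" where "shift g = inv (x 0) \<otimes> g \<otimes> x 0"

lemma bump_closed [simp, intro]: "bump i \<in> carrier G"
  by (simp add: bump_def)

lemma double_bump_closed [simp, intro]: "double_bump i \<in> carrier G"
  by (simp add: double_bump_def)

lemma bump_group_subgroup: "subgroup (bump_group p q) G"
  unfolding bump_group_def by (rule generate_is_subgroup) auto

lemma bump_group_closed: "g \<in> bump_group p q \<Longrightarrow> g \<in> carrier G"
  by (rule subgroup.mem_carrier[OF bump_group_subgroup])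

lemma bump_group_mult: "g \<in> bump_group p q \<Longrightarrow> h \<in> bump_group p q \<Longrightarrow> g \<otimes> h \<in> bump_group p q"
  by (rule subgroup.m_closed[OF bump_group_subgroup])

lemma bump_group_inv: "g \<in> bump_group p q \<Longrightarrow> inv g \<in> bump_group p q"
  by (rule subgroup.m_inv_closed[OF bump_group_subgroup])

lemma bump_group_one: "\<one> \<in> bump_group p q"
  by (rule subgroup.one_closed[OF bump_group_subgroup])

lemma bump_in_bump_group: "p \<le> i \<Longrightarrow> i < q \<Longrightarrow> bump i \<in> bump_group p q"
  unfolding bump_group_def by (auto intro: generate.incl)

lemma bump_group_mono: "g \<in> bump_group p q \<Longrightarrow> p' \<le> p \<Longrightarrow> q \<le> q' \<Longrightarrow> g \<in> bump_group p' q'"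
  unfolding bump_group_def by (rule subsetD[OF mono_generate]) auto

text \<open>
  The product of the consecutive bumps telescopes.
\<close>

lemma x_quotient_in_bump_group: "i \<le> j \<Longrightarrow> x i \<otimes> inv (x j) \<in> bump_group i j"
proof (induction rule: dec_induct)
  case base
  then show ?case by (simp add: bump_group_one)
next
  case (step j)
  have "(x i \<otimes> inv (x j)) \<otimes> bump j \<in> bump_group i (Suc j)"
    by (rule bump_group_mult[OF bump_group_mono[OF step.IH] bump_in_bump_group]) (use step in auto)
  then show ?case by (simp add: bump_def m_assoc)
qed

lemma double_bump_in_bump_group: "p \<le> i \<Longrightarrow> i + 2 \<le> q \<Longrightarrow> double_bump i \<in> bump_group p q"
  unfolding double_bump_def by (rule bump_group_mono[OF x_quotient_in_bump_group]) auto

text \<open>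
  Both \<open>x i\<close> and \<open>x (Suc i)\<close> shift \<open>x j\<close> by one, so their quotient fixes it. The bound \<open>i + 2\<close>
  makes the index of \<open>x j\<close> large enough for both.
\<close>

lemma bump_commute_x:
  assumes "i + 2 \<le> j"
  shows "bump i \<otimes> x j = x j \<otimes> bump i"
proof -
  have "bump i \<otimes> x j = x i \<otimes> (inv (x (Suc i)) \<otimes> x j)"
    by (simp add: bump_def m_assoc)
  also have "inv (x (Suc i)) \<otimes> x j = x (Suc j) \<otimes> inv (x (Suc i))"
    using assms by (intro intertwine_inv_left x_relation) auto
  also have "x i \<otimes> (x (Suc j) \<otimes> inv (x (Suc i))) = x j \<otimes> x i \<otimes> inv (x (Suc i))"
    using assms by (simp add: x_relation m_assoc)
  finally show ?thesis by (simp add: bump_def m_assoc)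
qed

lemma bump_group_commute_x: "g \<in> bump_group p q \<Longrightarrow> q < j \<Longrightarrow> g \<otimes> x j = x j \<otimes> g"
  unfolding bump_group_def by (erule generate_commute[rotated 3]) (auto intro: bump_commute_x)

text \<open>
  The algebraic form of the fact that elements with disjoint supports commute.
\<close>

lemma bump_group_commute:
  assumes "g \<in> bump_group p q" "h \<in> bump_group p' q'" "q < p'"
  shows "g \<otimes> h = h \<otimes> g"
proof -
  have "bump j \<otimes> g = g \<otimes> bump j" if "p' \<le> j" for j
  proof -
    have "x j \<otimes> g = g \<otimes> x j" "inv (x (Suc j)) \<otimes> g = g \<otimes> inv (x (Suc j))"
      using bump_group_commute_x[OF assms(1)] assms(3) that bump_group_closed[OF assms(1)]
      by (auto intro!: commute_inv)
    then show ?thesis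
      unfolding bump_def using bump_group_closed[OF assms(1)] by (intro commute_mult) auto
  qed
  then have "h \<otimes> g = g \<otimes> h"
    using assms(2) bump_group_closed[OF assms(1)] unfolding bump_group_def
    by (intro generate_commute[of "bump ` {p'..<q'}" g h]) auto
  then show ?thesis ..
qed

lemma shift_closed [simp, intro]: "g \<in> carrier G \<Longrightarrow> shift g \<in> carrier G"
  by (simp add: shift_def)

lemma shift_mult [simp]:
  "g \<in> carrier G \<Longrightarrow> h \<in> carrier G \<Longrightarrow> shift (g \<otimes> h) = shift g \<otimes> shift h"
  by (simp add: shift_def m_assoc)

lemma shift_inv [simp]: "g \<in> carrier G \<Longrightarrow> shift (inv g) = inv (shift g)"
  by (simp add: shift_def inv_mult_group m_assoc)

lemma shift_x: "0 < i \<Longrightarrow> shift (x i) = x (Suc i)"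
  using x_relation[of 0 i] by (simp add: shift_def m_assoc)

lemma shift_bump: "0 < i \<Longrightarrow> shift (bump i) = bump (Suc i)"
  by (simp add: bump_def shift_x)

lemma shift_double_bump: "0 < i \<Longrightarrow> shift (double_bump i) = double_bump (Suc i)"
  by (simp add: double_bump_def shift_x)

lemma shift_one [simp]: "shift \<one> = \<one>"
  by (simp add: shift_def)

lemma shift_bump_group: "g \<in> bump_group p q \<Longrightarrow> 0 < p \<Longrightarrow> shift g \<in> bump_group (Suc p) (Suc q)"
  unfolding bump_group_def
proof (induction rule: generate.induct)
  case one
  then show ?case by (simp add: generate.one)
next
  case (incl h)
  then show ?case by (auto simp: shift_bump intro!: generate.incl)
next
  case (inv h)
  then show ?case by (auto simp: shift_bump intro!: generate.inv)
next
  case (eng g h)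
  then have "g \<in> carrier G" "h \<in> carrier G"
    using bump_group_closed unfolding bump_group_def by blast+
  then show ?case using eng by (auto intro: generate.eng)
qed

lemma funpow_shift_closed [simp, intro]: "g \<in> carrier G \<Longrightarrow> (shift ^^ k) g \<in> carrier G"
  by (induction k) auto

lemma funpow_shift_mult [simp]:
  "g \<in> carrier G \<Longrightarrow> h \<in> carrier G \<Longrightarrow> (shift ^^ k) (g \<otimes> h) = (shift ^^ k) g \<otimes> (shift ^^ k) h"
  by (induction k) auto

lemma funpow_shift_x: "0 < i \<Longrightarrow> (shift ^^ k) (x i) = x (i + k)"
  by (induction k) (auto simp: shift_x)

lemma funpow_shift_double_bump: "0 < i \<Longrightarrow> (shift ^^ k) (double_bump i) = double_bump (i + k)"
  by (induction k) (auto simp: shift_double_bump)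

lemma funpow_shift_bump_group: "g \<in> bump_group p q \<Longrightarrow> 0 < p \<Longrightarrow> (shift ^^ k) g \<in> bump_group (p + k) (q + k)"
  by (induction k) (auto intro: shift_bump_group)

text \<open>
  This identity is the reason for using double bumps: the commutator of two neighbouring ones is
  a single bump. So a double bump, which is a product of bumps, is enough to recover bumps from
  an element that is otherwise unknown.
\<close>

lemma commutator_double_bumps: "commutator (double_bump (Suc i)) (double_bump i) = bump (Suc i)"
proof -
  define y where "y k = x (i + k)" for k
  have [simp]: "y k \<in> carrier G" for k by (simp add: y_def)
  have rel: "y 1 \<otimes> y 0 = y 0 \<otimes> y 2" "y 3 \<otimes> y 0 = y 0 \<otimes> y 4" "y 3 \<otimes> y 2 = y 2 \<otimes> y 4"
    using x_relation[of i "i + 1"] x_relation[of i "i + 3"] x_relation[of "i + 2" "i + 3"]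
    by (simp_all add: y_def numeral_eq_Suc)
  have "commutator (double_bump (Suc i)) (double_bump i) =
      y 1 \<otimes> inv (y 3) \<otimes> y 2 \<otimes> inv (y 0) \<otimes> y 3 \<otimes> (inv (y 1) \<otimes> y 0) \<otimes> inv (y 2)"
    by (simp add: commutator_def double_bump_def inv_mult_group m_assoc y_def numeral_eq_Suc)
  also have "inv (y 1) \<otimes> y 0 = y 0 \<otimes> inv (y 2)"
    by (rule intertwine_inv_right[OF rel(1)]) auto
  also have "y 1 \<otimes> inv (y 3) \<otimes> y 2 \<otimes> inv (y 0) \<otimes> y 3 \<otimes> (y 0 \<otimes> inv (y 2)) \<otimes> inv (y 2) =
      y 1 \<otimes> inv (y 3) \<otimes> y 2 \<otimes> inv (y 0) \<otimes> (y 3 \<otimes> y 0) \<otimes> inv (y 2) \<otimes> inv (y 2)"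
    by (simp add: m_assoc)
  also have "\<dots> = y 1 \<otimes> inv (y 3) \<otimes> (y 2 \<otimes> y 4) \<otimes> inv (y 2) \<otimes> inv (y 2)"
    by (simp add: rel(2) m_assoc)
  also have "\<dots> = y 1 \<otimes> inv (y 2)"
    by (simp add: rel(3)[symmetric] m_assoc)
  also have "\<dots> = bump (Suc i)"
    by (simp add: y_def bump_def)
  finally show ?thesis .
qed

text \<open>
  The quotient of \<open>x p\<close> and a far generator acts on \<open>g\<close> like \<open>x p\<close>, because the far generator
  commutes with \<open>g\<close>; and that quotient is a product of bumps.
\<close>

lemma conj_x_bump_group:
  assumes "g \<in> bump_group p q" "p \<le> q"
  shows "x p \<otimes> g \<otimes> inv (x p) \<in> bump_group p (Suc q)"
proof -
  let ?d = "x p \<otimes> inv (x (Suc q))"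
  have g: "g \<in> carrier G" using assms bump_group_closed by blast
  have "x p \<otimes> g \<otimes> inv (x p) = ?d \<otimes> g \<otimes> inv ?d"
  proof -
    have "inv (x (Suc q)) \<otimes> g = g \<otimes> inv (x (Suc q))"
      using bump_group_commute_x[OF assms(1), of "Suc q"] g by (intro commute_inv) auto
    then have "?d \<otimes> g = x p \<otimes> g \<otimes> inv (x (Suc q))"
      using g by (simp add: m_assoc)
    then show ?thesis using g by (simp add: inv_mult_group m_assoc)
  qed
  moreover have "?d \<in> bump_group p (Suc q)" using assms by (intro x_quotient_in_bump_group) auto
  moreover have "g \<in> bump_group p (Suc q)" by (rule bump_group_mono[OF assms(1)]) auto
  ultimately show ?thesis by (auto intro!: bump_group_mult bump_group_inv)
qed

lemma conj_x_pow_bump_group: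
  assumes "g \<in> bump_group p q" "p \<le> q"
  shows "x p [^] (m::nat) \<otimes> g \<otimes> inv (x p [^] m) \<in> bump_group p (q + m)"
  using assms
proof (induction m arbitrary: g q)
  case 0
  then show ?case using bump_group_closed by simp
next
  case (Suc m)
  have "x p [^] m \<otimes> (x p \<otimes> g \<otimes> inv (x p)) \<otimes> inv (x p [^] m) \<in> bump_group p (Suc q + m)"
    using Suc.prems by (intro Suc.IH conj_x_bump_group) auto
  then show ?case
    using bump_group_closed[OF Suc.prems(1)] by (simp add: m_assoc inv_mult_group)
qed

section \<open>A generating pair\<close>

context
  fixes H
  assumes H: "subgroup H G" and x0: "x 0 \<in> H"
begin

lemma H_mult: "g \<in> H \<Longrightarrow> h \<in> H \<Longrightarrow> g \<otimes> h \<in> H"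
  by (rule subgroup.m_closed[OF H])

lemma H_inv: "g \<in> H \<Longrightarrow> inv g \<in> H"
  by (rule subgroup.m_inv_closed[OF H])

lemma shift_in_subgroup: "g \<in> H \<Longrightarrow> shift g \<in> H"
  unfolding shift_def by (intro H_mult H_inv x0)

lemma funpow_shift_in_subgroup: "g \<in> H \<Longrightarrow> (shift ^^ k) g \<in> H"
  by (induction k) (auto intro: shift_in_subgroup)

lemma unshift_in_subgroup:
  assumes "shift g \<in> H" "g \<in> carrier G"
  shows "g \<in> H"
proof -
  have "x 0 \<otimes> shift g \<otimes> inv (x 0) \<in> H"
    by (intro H_mult H_inv x0 assms(1))
  then show ?thesis using assms(2) by (simp add: shift_def m_assoc)
qed

text \<open>
  A family that conjugation by \<open>x 0\<close> shifts is contained in the subgroup as soon as one member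
  of positive index is, since indices can be lowered as well as raised, down to \<open>1\<close>.
\<close>

lemma shift_orbit_in_subgroup:
  assumes "g (Suc j) \<in> H" "\<And>i. g i \<in> carrier G" "\<And>i. shift (g (Suc i)) = g (Suc (Suc i))" "0 < i"
  shows "g i \<in> H"
proof -
  have "g (Suc 0) \<in> H"
    using assms(1) by (induction j) (metis assms(2,3) unshift_in_subgroup)+
  then have "g (Suc i) \<in> H" for i
    by (induction i) (metis assms(3) shift_in_subgroup)+
  then show ?thesis using assms(4) by (cases i) auto
qed

text \<open>
  Let \<open>b\<close> be \<open>\<beta> \<otimes> x (2 * N + 1)\<close>. The \<open>N\<close>-th shift of \<open>b\<close> consists of \<open>\<gamma>\<close>, which is too far from
  \<open>\<beta>\<close> and from the tail of \<open>b\<close> to be affected by conjugation with \<open>b\<close>, and of a tail whose index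
  this conjugation raises by one. Two conjugations therefore turn its tail into that of the
  shift by \<open>N + 2\<close>, and the quotient of the two has no tail. One conjugation would also cancel
  the tail, but with two the remaining factors have a distance that is large enough for the use
  made of them in \<open>generating_pair\<close>.
\<close>

lemma tail_elimination:
  assumes \<beta>: "\<beta> \<in> bump_group 1 N" and N: "0 < N" and b: "\<beta> \<otimes> x (2 * N + 1) \<in> H"
  shows "(shift ^^ N) \<beta> \<otimes> inv ((shift ^^ (N + 2)) \<beta>) \<in> H"
proof -
  define M where "M = 2 * N + 1"
  define b where "b = \<beta> \<otimes> x M"
  define \<gamma> where "\<gamma> = (shift ^^ N) \<beta>"
  have bH: "b \<in> H" using b by (simp add: b_def M_def)
  have [simp]: "\<beta> \<in> carrier G" using \<beta> by (rule bump_group_closed)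
  then have [simp]: "b \<in> carrier G" "\<gamma> \<in> carrier G" by (simp_all add: b_def \<gamma>_def)
  have \<gamma>: "\<gamma> \<in> bump_group (1 + N) (N + N)"
    unfolding \<gamma>_def by (rule funpow_shift_bump_group[OF \<beta>]) simp
  \<comment> \<open>\<open>\<gamma>\<close> has its support between those of \<open>\<beta>\<close> and of the
    tail of \<open>b\<close>.\<close>
  have \<gamma>_b: "\<gamma> \<otimes> b = b \<otimes> \<gamma>"
  proof -
    have "\<beta> \<otimes> \<gamma> = \<gamma> \<otimes> \<beta>" by (rule bump_group_commute[OF \<beta> \<gamma>]) simp
    moreover have "x M \<otimes> \<gamma> = \<gamma> \<otimes> x M"
      by (rule bump_group_commute_x[OF \<gamma>, symmetric]) (simp add: M_def)
    ultimately have "b \<otimes> \<gamma> = \<gamma> \<otimes> b"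
      unfolding b_def by (intro commute_mult) simp_all
    then show ?thesis ..
  qed
  have x_b: "x j \<otimes> b = b \<otimes> x (Suc j)" if "M < j" for j
  proof -
    have "x j \<otimes> b = x j \<otimes> \<beta> \<otimes> x M" by (simp add: b_def m_assoc)
    also have "x j \<otimes> \<beta> = \<beta> \<otimes> x j"
      using bump_group_commute_x[OF \<beta>, of j] that by (simp add: M_def)
    also have "\<beta> \<otimes> x j \<otimes> x M = \<beta> \<otimes> (x M \<otimes> x (Suc j))"
      using that by (simp add: m_assoc x_relation)
    finally show ?thesis by (simp add: b_def m_assoc)
  qed
  have conj_b: "inv b \<otimes> (\<gamma> \<otimes> x j) \<otimes> b = \<gamma> \<otimes> x (Suc j)" if "M < j" for j
  proof -
    have "(\<gamma> \<otimes> x j) \<otimes> b = \<gamma> \<otimes> b \<otimes> x (Suc j)"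
      using that by (simp add: m_assoc x_b)
    also have "\<dots> = b \<otimes> (\<gamma> \<otimes> x (Suc j))" by (simp add: \<gamma>_b m_assoc)
    finally show ?thesis by (simp add: m_assoc)
  qed
  have shifted: "(shift ^^ k) b = (shift ^^ k) \<beta> \<otimes> x (M + k)" for k
    by (simp add: b_def funpow_shift_x M_def)
  have "inv b \<otimes> (inv b \<otimes> (shift ^^ N) b \<otimes> b) \<otimes> b \<in> H"
    by (intro H_mult H_inv funpow_shift_in_subgroup bH)
  then have "\<gamma> \<otimes> x (M + (N + 2)) \<in> H"
    using N by (simp add: shifted \<gamma>_def[symmetric] conj_b)
  then have "\<gamma> \<otimes> x (M + (N + 2)) \<otimes> inv ((shift ^^ (N + 2)) b) \<in> H"
    by (rule H_mult) (intro H_inv funpow_shift_in_subgroup bH)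
  then show ?thesis
    unfolding shifted \<gamma>_def by (simp add: m_assoc inv_mult_group del: funpow.simps)
qed

end

text \<open>
  The element \<open>f\<close> is arbitrary between the two double bumps. Among the shifts of
  \<open>double_bump 1 \<otimes> f \<otimes> double_bump n\<close>, the second and the \<open>(n + 2)\<close>-nd overlap only in the
  double bumps with indices \<open>n + 2\<close> and \<open>n + 3\<close>, hence their commutator is a bump that does not
  depend on \<open>f\<close>.
\<close>

lemma generating_pair:
  assumes f: "f \<in> bump_group 5 n" and n: "5 \<le> n"
  defines "b \<equiv> double_bump 1 \<otimes> f \<otimes> double_bump n \<otimes> x (2 * n + 5)"
  shows "x i \<in> generate G {x 0, b}"
proof -
  define H where "H = generate G {x 0, b}"
  define N where "N = n + 2"
  define M where "M = 2 * N + 1"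
  define \<beta> where "\<beta> = double_bump 1 \<otimes> f \<otimes> double_bump n"
  define \<beta>' where "\<beta>' k = (shift ^^ k) \<beta>" for k
  have N: "0 < N" by (simp add: N_def)
  have M: "M = 2 * n + 5" by (simp add: M_def N_def)
  have b: "b = \<beta> \<otimes> x M" unfolding b_def \<beta>_def M ..
  have [simp]: "f \<in> carrier G" using f bump_group_closed by blast
  have \<beta>_bump_group: "\<beta> \<in> bump_group 1 N"
    unfolding \<beta>_def N_def using n by (intro bump_group_mult double_bump_in_bump_group bump_group_mono[OF f]) auto
  then have [simp]: "\<beta> \<in> carrier G" by (rule bump_group_closed)
  then have [simp]: "b \<in> carrier G" "\<beta>' k \<in> carrier G" for k by (simp_all add: b \<beta>'_def)
  have \<beta>'_bump_group: "\<beta>' k \<in> bump_group (1 + k) (N + k)" for k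
    unfolding \<beta>'_def by (rule funpow_shift_bump_group[OF \<beta>_bump_group]) simp
  have H: "subgroup H G"
    unfolding H_def by (rule generate_is_subgroup) auto
  have x0: "x 0 \<in> H" and bH: "b \<in> H"
    unfolding H_def by (auto intro: generate.incl)
  note H_mult = H_mult[OF H x0] and H_inv = H_inv[OF H x0]
  \<comment> \<open>In the commutator of \<open>u\<close> and \<open>w\<close> below, the factor \<open>inv
    (\<beta>' (N + 2))\<close> and the tail of \<open>w\<close> are too far to the right to
    contribute.\<close>
  define u where "u = \<beta>' N \<otimes> inv (\<beta>' (N + 2))"
  have uH: "u \<in> H"
    unfolding u_def \<beta>'_def
    by (rule tail_elimination[OF H x0 \<beta>_bump_group N]) (use bH in \<open>simp add: b M_def\<close>)
  define w where "w = (shift ^^ 2) b"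
  have wH: "w \<in> H"
    unfolding w_def by (rule funpow_shift_in_subgroup[OF H x0 bH])
  have w: "w = \<beta>' 2 \<otimes> x (M + 2)"
    unfolding w_def b \<beta>'_def by (subst funpow_shift_mult) (auto simp: funpow_shift_x M_def)
  then have [simp]: "w \<in> carrier G" by simp
  have w_commute: "g \<otimes> w = w \<otimes> g" if g: "g \<in> bump_group (N + 3) (2 * N + 2)" for g
  proof -
    have "\<beta>' 2 \<otimes> g = g \<otimes> \<beta>' 2"
      by (rule bump_group_commute[OF \<beta>'_bump_group g]) simp
    moreover have "x (M + 2) \<otimes> g = g \<otimes> x (M + 2)"
      by (rule bump_group_commute_x[OF g, symmetric]) (simp add: M_def)
    ultimately have "w \<otimes> g = g \<otimes> w"
      unfolding w using bump_group_closed[OF g] by (intro commute_mult) simp_all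
    then show ?thesis ..
  qed
  \<comment> \<open>\<open>s\<close> is what \<open>u\<close> contains besides its leftmost double bump, and
    \<open>r\<close> is what \<open>w\<close> contains besides its rightmost one; the
    absorption rules remove both.\<close>
  have "commutator u w = bump (Suc N)"
  proof -
    define s where "s = (shift ^^ N) (f \<otimes> double_bump n) \<otimes> inv (\<beta>' (N + 2))"
    define r where "r = double_bump 3 \<otimes> (shift ^^ 2) f \<otimes> x (M + 2)"
    have u: "u = double_bump (Suc N) \<otimes> s"
      unfolding u_def s_def using N by (simp add: \<beta>'_def \<beta>_def funpow_shift_double_bump m_assoc)
    have "f \<otimes> double_bump n \<in> bump_group 5 (n + 2)"
      using n by (intro bump_group_mult bump_group_mono[OF f] double_bump_in_bump_group) auto
    then have s1: "(shift ^^ N) (f \<otimes> double_bump n) \<in> bump_group (5 + N) (n + 2 + N)"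
      by (rule funpow_shift_bump_group) simp
    have s: "s \<in> bump_group (N + 3) (2 * N + 2)"
      unfolding s_def by (intro bump_group_mult bump_group_inv bump_group_mono[OF s1] bump_group_mono[OF \<beta>'_bump_group]) (auto simp: N_def)
    have double_bump_x: "double_bump N \<otimes> x (M + 2) = x (M + 2) \<otimes> double_bump N"
      by (rule bump_group_commute_x[OF double_bump_in_bump_group[OF order_refl order_refl]]) (simp add: M_def)
    have w: "w = r \<otimes> double_bump N"
    proof -
      have "(shift ^^ 2) (double_bump 1) = double_bump 3" "(shift ^^ 2) (double_bump n) = double_bump N"
        using n funpow_shift_double_bump[of 1 2] funpow_shift_double_bump[of n 2] by (simp_all add: N_def numeral_eq_Suc)
      then have "\<beta>' 2 = double_bump 3 \<otimes> (shift ^^ 2) f \<otimes> double_bump N"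
        unfolding \<beta>'_def \<beta>_def by (subst funpow_shift_mult; simp)+
      then show ?thesis
        unfolding w r_def using double_bump_x by (simp add: m_assoc)
    qed
    have [simp]: "s \<in> carrier G" "r \<in> carrier G"
      using s bump_group_closed by (auto simp: r_def)
    have r_double_bump: "r \<otimes> double_bump (Suc N) = double_bump (Suc N) \<otimes> r"
    proof -
      have double_bump_group: "double_bump (Suc N) \<in> bump_group (Suc N) (N + 3)" by (rule double_bump_in_bump_group) auto
      have "double_bump 3 \<otimes> (shift ^^ 2) f \<in> bump_group 3 N"
        unfolding N_def using n
        by (intro bump_group_mult double_bump_in_bump_group bump_group_mono[OF funpow_shift_bump_group[OF f]]) auto
      then have "double_bump 3 \<otimes> (shift ^^ 2) f \<otimes> double_bump (Suc N) = double_bump (Suc N) \<otimes> (double_bump 3 \<otimes> (shift ^^ 2) f)"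
        by (rule bump_group_commute[OF _ double_bump_group]) simp
      moreover have "x (M + 2) \<otimes> double_bump (Suc N) = double_bump (Suc N) \<otimes> x (M + 2)"
        by (rule bump_group_commute_x[OF double_bump_group, symmetric]) (use N in \<open>simp add: M_def\<close>)
      ultimately show ?thesis
        unfolding r_def by (rule commute_mult) auto
    qed
    have "commutator u w = commutator (double_bump (Suc N)) w"
      unfolding u by (rule commutator_absorb_left[OF w_commute[OF s]]) auto
    also have "\<dots> = commutator (double_bump (Suc N)) (double_bump N)"
      unfolding w by (rule commutator_absorb_right[OF r_double_bump]) auto
    finally show ?thesis by (simp add: commutator_double_bumps)
  qed
  moreover have "commutator u w \<in> H"
    unfolding commutator_def by (intro H_mult H_inv uH wH)
  ultimately have cN: "bump (Suc N) \<in> H" by simp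
  \<comment> \<open>From one bump all of them are obtained, hence \<open>\<beta>\<close>, and only the tail of
    \<open>b\<close> is left.\<close>
  have "bump i \<in> H" if "0 < i" for i
    by (rule shift_orbit_in_subgroup[OF H x0, where g = bump, OF cN]) (use that in \<open>auto simp: shift_bump\<close>)
  then have "bump ` {1..<N} \<subseteq> H" by auto
  then have "bump_group 1 N \<subseteq> H"
    unfolding bump_group_def by (rule generate_subgroup_incl[OF _ H])
  then have "inv \<beta> \<otimes> b \<in> H"
    using \<beta>_bump_group by (intro H_mult H_inv bH) auto
  then have "x (Suc (2 * N)) \<in> H" by (simp add: b M_def)
  then have "x i \<in> H" if "0 < i" for i
    by (rule shift_orbit_in_subgroup[OF H x0, where g = x]) (use that in \<open>auto simp: shift_x\<close>)
  with x0 show ?thesis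
    unfolding H_def by (cases i) auto
qed

end


section \<open>The action on the half line\<close>

lemma F_mult_apply: "0 \<le> t \<Longrightarrow> (g \<otimes>\<^bsub>thompson_F\<^esub> h) t = h (g t)"
  by (simp add: thompson_F_def homeo_group_def compose_def)

lemma F_one_apply: "0 \<le> t \<Longrightarrow> \<one>\<^bsub>thompson_F\<^esub> t = t"
  by (simp add: thompson_F_def homeo_group_def)

lemma thompson_gen_relation:
  assumes "i < j"
  shows "thompson_gen j \<otimes>\<^bsub>thompson_F\<^esub> thompson_gen i = thompson_gen i \<otimes>\<^bsub>thompson_F\<^esub> thompson_gen (Suc j)"
proof
  fix t :: real
  have "real i + 1 \<le> real j" using assms by simp
  then show "(thompson_gen j \<otimes>\<^bsub>thompson_F\<^esub> thompson_gen i) t =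
      (thompson_gen i \<otimes>\<^bsub>thompson_F\<^esub> thompson_gen (Suc j)) t"
    by (auto simp: thompson_F_def homeo_group_def compose_def thompson_gen_def restrict_def)
qed

interpretation F: thompson_relations thompson_F thompson_gen
proof -
  interpret group thompson_F by (rule group_thompson_F)
  show "thompson_relations thompson_F thompson_gen"
  proof
    show "thompson_gen i \<in> carrier thompson_F" for i
      by (simp add: thompson_F_def generate.incl)
  qed (rule thompson_gen_relation)
qed

lemma generate_thompson_gen: "generate thompson_F (range thompson_gen) = carrier thompson_F"
proof -
  interpret group homeo_group by (rule group_homeo_group)
  have "subgroup (generate homeo_group (range thompson_gen)) homeo_group"
    using thompson_gen_in_homeo_group by (intro generate_is_subgroup) auto
  then have "generate (homeo_group\<lparr>carrier := generate homeo_group (range thompson_gen)\<rparr>) (range thompson_gen) =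
      generate homeo_group (range thompson_gen)"
    by (intro generate_consistent) (auto intro: generate.incl)
  then show ?thesis by (simp add: thompson_F_def)
qed

lemma F_nonneg:
  assumes "g \<in> carrier thompson_F" "0 \<le> t"
  shows "0 \<le> g t"
proof -
  interpret group homeo_group by (rule group_homeo_group)
  have "g \<in> carrier homeo_group"
    using assms(1) thompson_gen_in_homeo_group
    by (intro generate_in_carrier[of "range thompson_gen"]) (auto simp: thompson_F_def)
  then show ?thesis
    using assms(2) by (auto simp: homeo_group_def homeomorphism_def)
qed

lemma F_inv_apply:
  assumes "g \<in> carrier thompson_F" "0 \<le> s" "g s = t"
  shows "(inv\<^bsub>thompson_F\<^esub> g) t = s"
proof -
  have "(inv\<^bsub>thompson_F\<^esub> g) (g s) = (g \<otimes>\<^bsub>thompson_F\<^esub> inv\<^bsub>thompson_F\<^esub> g) s"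
    using assms(2) by (simp only: F_mult_apply)
  also have "\<dots> = s"
    using assms(1,2) by (simp add: F_one_apply)
  finally show ?thesis by (simp only: assms(3))
qed

lemma thompson_gen_apply:
  "0 \<le> t \<Longrightarrow> t \<le> real i \<Longrightarrow> thompson_gen i t = t"
  "real i \<le> t \<Longrightarrow> t \<le> real i + 1 \<Longrightarrow> thompson_gen i t = 2 * t - real i"
  "real i + 1 \<le> t \<Longrightarrow> thompson_gen i t = t + 1"
  by (auto simp: thompson_gen_def)

lemma thompson_gen_mono: "0 \<le> s \<Longrightarrow> s \<le> t \<Longrightarrow> thompson_gen i s \<le> thompson_gen i t"
  by (auto simp: thompson_gen_def)

lemma thompson_gen_pow_mono:
  "0 \<le> s \<Longrightarrow> s \<le> t \<Longrightarrow> (thompson_gen i [^]\<^bsub>thompson_F\<^esub> (m::nat)) s \<le> (thompson_gen i [^]\<^bsub>thompson_F\<^esub> m) t"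
proof (induction m)
  case (Suc m)
  then show ?case
    using F_nonneg[of "thompson_gen i [^]\<^bsub>thompson_F\<^esub> m" s]
    by (simp add: F_mult_apply thompson_gen_mono)
qed (simp add: F_one_apply)

text \<open>
  Next to its fixed point \<open>i\<close> the generator doubles distances, up to the point \<open>i + 1\<close> which it
  moves to \<open>i + 2\<close>.
\<close>

lemma thompson_gen_pow_dilation:
  assumes "0 \<le> y" "2 ^ m * y \<le> 2"
  shows "(thompson_gen i [^]\<^bsub>thompson_F\<^esub> (m::nat)) (real i + y) = real i + 2 ^ m * y"
  using assms(2)
proof (induction m)
  case (Suc m)
  then have "2 ^ m * y \<le> 1" by simp
  then show ?case
    using Suc assms(1) by (simp add: F_mult_apply thompson_gen_apply(2))
qed (simp add: F_one_apply assms)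

lemma bump_apply:
  assumes "0 \<le> s" "0 \<le> t" "thompson_gen (Suc i) s = thompson_gen i t"
  shows "F.bump i t = s"
  using assms by (simp add: F.bump_def F_mult_apply F_inv_apply)

lemma bump_fixes: "0 \<le> t \<Longrightarrow> t \<le> real i \<or> real i + 2 \<le> t \<Longrightarrow> F.bump i t = t"
  by (rule bump_apply) (auto simp: thompson_gen_apply)

lemma double_bump_fixes: "0 \<le> t \<Longrightarrow> t \<le> real i \<or> real i + 3 \<le> t \<Longrightarrow> F.double_bump i t = t"
  unfolding F.double_bump_def by (simp add: F_mult_apply, rule F_inv_apply) (auto simp: thompson_gen_apply)

text \<open>
  Halving the distance to the left end \<open>p\<close> of the unit interval leads from each point to the
  next; the factor \<open>3\<close> keeps them off the points \<open>p + 1 / 2 ^ k\<close>, which bound the supports of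
  the half steps below.
\<close>

definition grid :: "int \<Rightarrow> nat \<Rightarrow> real" where
  "grid p j = of_int p + 3 / 2 ^ (j + 3)"

lemma grid_bounds: "of_int p < grid p j" "grid p j < of_int p + 1"
proof -
  have "(2::real) ^ 3 \<le> 2 ^ (j + 3)" by (rule power_increasing) auto
  then have "(3::real) < 2 ^ (j + 3)" by simp
  then show "of_int p < grid p j" "grid p j < of_int p + 1"
    by (simp_all add: grid_def divide_less_eq)
qed

lemma grid_inj: "grid p j = grid p' j' \<longleftrightarrow> p = p' \<and> j = j'"
proof
  assume eq: "grid p j = grid p' j'"
  then have "p = p'"
    using grid_bounds[of p j] grid_bounds[of p' j'] by linarith
  with eq show "p = p' \<and> j = j'" by (auto simp: grid_def)
qed simp

text \<open>
  The power \<open>X\<close> carries the points \<open>grid p (Suc j)\<close> and \<open>grid p j\<close> to \<open>p + 3/2\<close> and \<open>p + 5/2\<close>.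
  The bump at \<open>Suc p\<close> moves \<open>p + 3/2\<close> to \<open>p + 2\<close> and \<open>p + 2\<close> to \<open>p + 5/2\<close>, and fixes the images
  of all other grid points; hence the inverse of its square, conjugated by \<open>X\<close>, moves a single
  grid point to the next one.
\<close>

definition half_step :: "nat \<Rightarrow> nat \<Rightarrow> real \<Rightarrow> real" where
  "half_step p j = (let X = thompson_gen p [^]\<^bsub>thompson_F\<^esub> (j + 3); d = inv\<^bsub>thompson_F\<^esub> F.bump (Suc p) in
     X \<otimes>\<^bsub>thompson_F\<^esub> (d \<otimes>\<^bsub>thompson_F\<^esub> d) \<otimes>\<^bsub>thompson_F\<^esub> inv\<^bsub>thompson_F\<^esub> X)"

lemma half_step_in_bump_group: "half_step p j \<in> F.bump_group p (p + 5 + j)"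
proof -
  have "F.bump (Suc p) \<in> F.bump_group p (p + 2)" by (rule F.bump_in_bump_group) auto
  then show ?thesis
    unfolding half_step_def Let_def
    using F.conj_x_pow_bump_group[OF F.bump_group_mult[OF F.bump_group_inv F.bump_group_inv], of "F.bump (Suc p)" p "p + 2" "F.bump (Suc p)" "j + 3"]
    by (simp add: algebra_simps)
qed

lemma half_step_apply:
  assumes "0 \<le> s" "0 \<le> t" "thompson_gen p [^]\<^bsub>thompson_F\<^esub> (j + 3) = X"
    "F.bump (Suc p) (F.bump (Suc p) (X t)) = X s"
  shows "half_step p j s = t"
proof -
  have X: "X \<in> carrier thompson_F" using assms(3) by auto
  define d where "d = F.bump (Suc p)"
  have d: "d \<in> carrier thompson_F" by (simp add: d_def)
  have nn: "0 \<le> X s" "0 \<le> X t" "0 \<le> d (X t)" "0 \<le> d (d (X t))"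
    using X d assms(1,2) by (simp_all add: F_nonneg)
  have "(inv\<^bsub>thompson_F\<^esub> d) (X s) = d (X t)"
    by (rule F_inv_apply) (use d nn assms(4) in \<open>auto simp: d_def\<close>)
  moreover have "(inv\<^bsub>thompson_F\<^esub> d) (d (X t)) = X t"
    by (rule F_inv_apply) (use d nn in auto)
  moreover have "(inv\<^bsub>thompson_F\<^esub> X) (X t) = t"
    by (rule F_inv_apply) (use X assms in auto)
  ultimately show ?thesis
    unfolding half_step_def Let_def assms(3) d_def[symmetric]
    using nn assms(1) by (simp add: F_mult_apply)
qed

lemma half_step_grid: "half_step p j (grid (int p) j) = grid (int p) (Suc j)"
proof (rule half_step_apply[OF _ _ refl])
  show "0 \<le> grid (int p) j" "0 \<le> grid (int p) (Suc j)"
    by (simp_all add: grid_def)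
  have 1: "(thompson_gen p [^]\<^bsub>thompson_F\<^esub> (j + 3)) (grid (int p) (Suc j)) = real p + 3 / 2"
    unfolding grid_def by (subst of_int_of_nat_eq, subst thompson_gen_pow_dilation) (auto simp: power_add)
  have "(thompson_gen p [^]\<^bsub>thompson_F\<^esub> (j + 2)) (grid (int p) j) = real p + 3 / 2"
    unfolding grid_def by (subst of_int_of_nat_eq, subst thompson_gen_pow_dilation) (auto simp: power_add)
  moreover have "thompson_gen p [^]\<^bsub>thompson_F\<^esub> (j + 3) =
      thompson_gen p [^]\<^bsub>thompson_F\<^esub> (j + 2) \<otimes>\<^bsub>thompson_F\<^esub> thompson_gen p"
    by (simp add: numeral_3_eq_3)
  ultimately have 2: "(thompson_gen p [^]\<^bsub>thompson_F\<^esub> (j + 3)) (grid (int p) j) = real p + 5 / 2"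
    by (simp add: F_mult_apply grid_def thompson_gen_apply del: F.nat_pow_Suc)
  have "F.bump (Suc p) (real p + 3 / 2) = real p + 2" "F.bump (Suc p) (real p + 2) = real p + 5 / 2"
    by (rule bump_apply; simp add: thompson_gen_apply)+
  then show "F.bump (Suc p) (F.bump (Suc p) ((thompson_gen p [^]\<^bsub>thompson_F\<^esub> (j + 3)) (grid (int p) (Suc j)))) =
      (thompson_gen p [^]\<^bsub>thompson_F\<^esub> (j + 3)) (grid (int p) j)"
    by (simp only: 1 2)
qed

lemma half_step_fixes:
  assumes "0 \<le> t" "t \<le> real p + 1 / 2 ^ (j + 3) \<or> real p + 1 / 2 ^ (j + 1) \<le> t"
  shows "half_step p j t = t"
proof (rule half_step_apply[OF assms(1) assms(1) refl])
  define X where "X = thompson_gen p [^]\<^bsub>thompson_F\<^esub> (j + 3)"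
  have 1: "X (real p + 1 / 2 ^ (j + 3)) = real p + 1"
    unfolding X_def by (subst thompson_gen_pow_dilation) auto
  have "(thompson_gen p [^]\<^bsub>thompson_F\<^esub> (j + 2)) (real p + 1 / 2 ^ (j + 1)) = real p + 2"
    by (subst thompson_gen_pow_dilation) (auto simp: power_add)
  moreover have "X = thompson_gen p [^]\<^bsub>thompson_F\<^esub> (j + 2) \<otimes>\<^bsub>thompson_F\<^esub> thompson_gen p"
    by (simp add: X_def numeral_3_eq_3)
  ultimately have 2: "X (real p + 1 / 2 ^ (j + 1)) = real p + 3"
    by (simp add: F_mult_apply thompson_gen_apply del: F.nat_pow_Suc)
  have mono: "0 \<le> s \<Longrightarrow> s \<le> s' \<Longrightarrow> X s \<le> X s'" for s s'
    unfolding X_def by (rule thompson_gen_pow_mono)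
  have "X t \<le> real p + 1 \<or> real p + 3 \<le> X t"
    using assms(2)
  proof
    assume "t \<le> real p + 1 / 2 ^ (j + 3)"
    from mono[OF assms(1) this] show ?thesis using 1 by simp
  next
    assume "real p + 1 / 2 ^ (j + 1) \<le> t"
    from mono[OF _ this] show ?thesis using 2 by simp
  qed
  moreover have "0 \<le> X t"
    by (rule F_nonneg[OF _ assms(1)]) (simp add: X_def)
  ultimately have "F.bump (Suc p) (X t) = X t"
    by (intro bump_fixes) auto
  then show "F.bump (Suc p) (F.bump (Suc p) (X t)) = X t" by simp
qed

lemma half_step_fixes_grid:
  assumes "0 \<le> p'" "(p', j') \<noteq> (int p, j)" "(p', j') \<noteq> (int p, Suc j)"
  shows "half_step p j (grid p' j') = grid p' j'"
proof (rule half_step_fixes)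
  show "0 \<le> grid p' j'" using assms(1) by (simp add: grid_def)
  have le1: "1 / 2 ^ (j + 1) \<le> (1::real)"
    using one_le_power[of "2::real" "j + 1"] by (simp add: divide_le_eq del: one_le_power)
  consider "p' < int p" | "int p < p'" | "p' = int p" "j' < j" | "p' = int p" "Suc (Suc j) \<le> j'"
    using assms(2,3) by force
  then show "grid p' j' \<le> real p + 1 / 2 ^ (j + 3) \<or> real p + 1 / 2 ^ (j + 1) \<le> grid p' j'"
  proof cases
    case 1
    then have "grid p' j' < real p" using grid_bounds(2)[of p' j'] by linarith
    moreover have "0 \<le> 1 / (2::real) ^ (j + 3)" by simp
    ultimately show ?thesis by linarith
  next
    case 2
    then show ?thesis using grid_bounds(1)[of p' j'] le1 by linarith
  next
    case 3
    then have "(2::real) ^ (j' + 3) \<le> 2 ^ (j + 2)" by (intro power_increasing) auto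
    then have "3 / (2::real) ^ (j + 2) \<le> 3 / 2 ^ (j' + 3)" by (intro divide_left_mono) auto
    moreover have "1 / (2::real) ^ (j + 1) \<le> 3 / 2 ^ (j + 2)" by (simp add: field_simps)
    ultimately show ?thesis using 3 by (simp add: grid_def)
  next
    case 4
    then have "(2::real) ^ (j + 5) \<le> 2 ^ (j' + 3)" by (intro power_increasing) auto
    then have "3 / (2::real) ^ (j' + 3) \<le> 3 / 2 ^ (j + 5)" by (intro divide_left_mono) auto
    moreover have "3 / (2::real) ^ (j + 5) \<le> 1 / 2 ^ (j + 3)" by (simp add: field_simps power_add)
    ultimately show ?thesis using 4 by (simp add: grid_def)
  qed
qed


section \<open>Paths of reduced words\<close>

text \<open>
  Letter \<open>0\<close> will be read as \<open>thompson_gen 0\<close>, which changes the unit interval of a point, and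
  letter \<open>1\<close> as the second generator, which moves points within their unit interval.
\<close>

definition height :: "word \<Rightarrow> int" where
  "height w = (\<Sum>(i, e)\<leftarrow>w. if i = 0 then if e then 1 else - 1 else 0)"

definition b_count :: "word \<Rightarrow> nat" where
  "b_count w = length (filter (\<lambda>(i, e). i = 1) w)"

lemma height_simps [simp]:
  "height [] = 0"
  "height ((i, e) # w) = (if i = 0 then if e then 1 else - 1 else 0) + height w"
  "height (v @ w) = height v + height w"
  by (simp_all add: height_def)

lemma b_count_simps [simp]:
  "b_count [] = 0"
  "b_count ((i, e) # w) = (if i = 1 then 1 else 0) + b_count w"
  "b_count (v @ w) = b_count v + b_count w"
  by (simp_all add: b_count_def)

lemma abs_height_le: "\<bar>height w\<bar> \<le> int (length w)"
  by (induction w) auto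

lemma reduced_append: "reduced (v @ w) \<Longrightarrow> reduced v \<and> reduced w"
  by (simp add: reduced_def successively_append_iff)

text \<open>
  Without letters \<open>1\<close>, a reduced word repeats a single letter, so its height is plus or minus
  its length.
\<close>

lemma height_zero_imp_Nil:
  assumes "w \<in> words 2" "reduced w" "b_count w = 0" "height w = 0"
  shows "w = []"
proof (rule ccontr)
  have *: "height ((0, e) # u) = (if e then 1 else - 1) * int (Suc (length u))"
    if "u \<in> words 2" "reduced ((0, e) # u)" "b_count u = 0" for u e
    using that
  proof (induction u arbitrary: e)
    case (Cons x u)
    obtain i e' where x: "x = (i, e')" by (cases x)
    have "i = 0" using Cons.prems x by (auto split: if_splits)
    moreover have "e' = e" using Cons.prems x \<open>i = 0\<close> by (auto simp: reduced_Cons)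
    ultimately show ?case
      using Cons.IH[of e] Cons.prems x by (auto simp: reduced_Cons)
  qed simp
  assume "w \<noteq> []"
  then obtain i e u where w: "w = (i, e) # u" by (metis list.exhaust surj_pair)
  then have "i = 0" using assms by (auto split: if_splits)
  then show False
    using *[of u e] assms w by (auto split: if_splits)
qed

text \<open>
  Two reduced words can be joined by one letter so that the result is reduced: there are four
  letters, and at most two of them cancel against a neighbour.
\<close>

lemma ex_common_superword:
  assumes "finite W" "\<And>w. w \<in> W \<Longrightarrow> w \<in> words 2 \<and> reduced w"
  shows "\<exists>v. v \<in> words 2 \<and> reduced v \<and> (\<forall>w\<in>W. \<exists>u u'. v = u @ w @ u')"
  using assms
proof (induction rule: finite_induct)
  case empty
  then show ?case by (intro exI[of _ "[]"]) auto
next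
  case (insert w W)
  then obtain v where v: "v \<in> words 2" "reduced v" "\<forall>w\<in>W. \<exists>u u'. v = u @ w @ u'"
    by auto
  have w: "w \<in> words 2" "reduced w" using insert.prems by auto
  define A where "A = {inv_letter (last v), inv_letter (hd w)}"
  define B :: "(nat \<times> bool) set" where "B = {(0, True), (0, False), (1, True)}"
  have "card A < card B" by (simp add: A_def B_def card_insert_if)
  then have "\<not> B \<subseteq> A"
    using card_mono[of A B] by (auto simp: A_def)
  then obtain x where x: "x \<in> B" "x \<notin> A" by blast
  have "reduced (v @ [x] @ w)"
    using v(2) w(2) x(2) unfolding reduced_def A_def
    by (auto simp: successively_append_iff successively_Cons)
  moreover have "v @ [x] @ w \<in> words 2"
    using v(1) w(1) x(1) by (auto simp: B_def)
  moreover have "\<exists>u u'. v @ [x] @ w = u @ w' @ u'" if "w' \<in> insert w W" for w'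
  proof (cases "w' = w")
    case True
    then have "v @ [x] @ w = (v @ [x]) @ w' @ []" by simp
    then show ?thesis by (intro exI)
  next
    case False
    with that have "w' \<in> W" by simp
    from bspec[OF v(3) this] obtain u u' where "v = u @ w' @ u'" by (elim exE)
    then have "v @ [x] @ w = u @ w' @ (u' @ [x] @ w)" by simp
    then show ?thesis by (intro exI)
  qed
  ultimately show ?case by blast
qed

text \<open>
  The point prescribed as the image of the start after reading \<open>w\<close>. Letter \<open>1\<close> leads to the next
  grid point whatever its sign, so the path never returns.
\<close>

definition node :: "int \<Rightarrow> word \<Rightarrow> real" where
  "node h w = grid (h + height w) (b_count w)"

text \<open>
  The values that the second generator must take for the path of \<open>v\<close> to run through the
  prescribed points. A negative letter reads the condition backwards.
\<close>

definition realizes :: "int \<Rightarrow> word \<Rightarrow> (real \<Rightarrow> real) \<Rightarrow> bool" where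
  "realizes h v f \<longleftrightarrow> (\<forall>u e u'. v = u @ (1, e) # u' \<longrightarrow>
     (if e then f (node h u) = node h (u @ [(1, e)]) else f (node h (u @ [(1, e)])) = node h u))"

text \<open>
  Induction on the word. A new letter \<open>1\<close> is realized by composing with the half step \<open>z\<close> at the
  current grid point: \<open>z\<close> acts before \<open>f\<close> for a positive letter, and its inverse acts after \<open>f\<close>
  for a negative one, which works because \<open>f\<close> fixes the next grid point. A value prescribed
  earlier could be disturbed only if it concerned the immediately preceding step in the same
  unit interval. Then no letter \<open>0\<close> separates the two steps, so by reducedness they have the
  same sign, and in that case the order of composition keeps the old value.
\<close>

lemma ex_realizing_element:
  assumes "v \<in> words 2" "reduced v" "int (length v) + int p \<le> h"
  shows "\<exists>f q. f \<in> F.bump_group p q \<and> realizes h v f \<and>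
    (\<forall>k j. 0 \<le> k \<longrightarrow> b_count v < j \<longrightarrow> f (grid k j) = grid k j)"
  using assms
proof (induction v rule: rev_induct)
  case Nil
  show ?case
    by (intro exI[of _ "\<one>\<^bsub>thompson_F\<^esub>"] exI[of _ p] conjI)
       (auto simp: realizes_def F_one_apply grid_def F.bump_group_one)
next
  case (snoc x v)
  have v: "v \<in> words 2" "reduced v"
    using snoc.prems reduced_append[of v "[x]"] by simp_all
  obtain f q where f: "f \<in> F.bump_group p q" "realizes h v f"
    and f_fix: "\<And>k j. 0 \<le> k \<Longrightarrow> b_count v < j \<Longrightarrow> f (grid k j) = grid k j"
    using snoc.IH[OF v] snoc.prems by auto
  obtain i e where x: "x = (i, e)" by (cases x)
  show ?case
  proof (cases "i = 1")
    case False
    have "realizes h (v @ [x]) f"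
      unfolding realizes_def
    proof (intro allI impI)
      fix u e' u' assume eq: "v @ [x] = u @ (1, e') # u'"
      with False x have "u' \<noteq> []" by auto
      then have "v = u @ (1, e') # butlast u'"
        using arg_cong[OF eq, of butlast] by (simp add: butlast_append)
      then show "if e' then f (node h u) = node h (u @ [(1, e')])
          else f (node h (u @ [(1, e')])) = node h u"
        using f(2) unfolding realizes_def by blast
    qed
    then show ?thesis
      using f f_fix False x by (intro exI[of _ f] exI[of _ q]) auto
  next
    case True
    define k where "k = nat (h + height v)"
    define j where "j = b_count v"
    have k: "int k = h + height v" "p \<le> k"
      using abs_height_le[of v] snoc.prems(3) by (auto simp: k_def)
    have node_v: "node h v = grid (int k) j" "node h (v @ [(1, e')]) = grid (int k) (Suc j)" for e'
      using k by (simp_all add: node_def j_def)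
    define z where "z = half_step k j"
    have z_bump_group: "z \<in> F.bump_group p (max q (k + 5 + j))"
      unfolding z_def by (rule F.bump_group_mono[OF half_step_in_bump_group]) (use k in auto)
    then have z_carrier: "z \<in> carrier thompson_F" by (rule F.bump_group_closed)
    have z_v: "z (grid (int k) j) = grid (int k) (Suc j)"
      unfolding z_def by (rule half_step_grid)
    have z_fix: "z (grid k' j') = grid k' j'"
      if "0 \<le> k'" "(k', j') \<noteq> (int k, j)" "(k', j') \<noteq> (int k, Suc j)" for k' j'
      unfolding z_def by (rule half_step_fixes_grid[OF that])
    have grid_nn: "0 \<le> grid k' j'" if "0 \<le> k'" for k' j'
      using that by (simp add: grid_def)
    have z_inv_v: "(inv\<^bsub>thompson_F\<^esub> z) (grid (int k) (Suc j)) = grid (int k) j"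
      by (rule F_inv_apply[OF z_carrier _ z_v]) (simp add: grid_nn)
    have z_inv_fix: "(inv\<^bsub>thompson_F\<^esub> z) (grid k' j') = grid k' j'"
      if "0 \<le> k'" "(k', j') \<noteq> (int k, j)" "(k', j') \<noteq> (int k, Suc j)" for k' j'
      by (rule F_inv_apply[OF z_carrier grid_nn z_fix]) (use that in auto)
    define f' where "f' = (if e then z \<otimes>\<^bsub>thompson_F\<^esub> f else f \<otimes>\<^bsub>thompson_F\<^esub> inv\<^bsub>thompson_F\<^esub> z)"
    have f'_grid: "f' (grid k' j') = (if e then f (z (grid k' j')) else (inv\<^bsub>thompson_F\<^esub> z) (f (grid k' j')))"
      if "0 \<le> k'" for k' j'
      using grid_nn[OF that] by (simp add: f'_def F_mult_apply)
    have "f' \<in> F.bump_group p (max q (k + 5 + j))"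
      unfolding f'_def using z_bump_group F.bump_group_mono[OF f(1), of p "max q (k + 5 + j)"]
      by (auto intro: F.bump_group_mult F.bump_group_inv)
    moreover have "f' (grid k' j') = grid k' j'" if "0 \<le> k'" "Suc j < j'" for k' j'
      using that f_fix[of k' j'] z_fix[of k' j'] z_inv_fix[of k' j'] by (simp add: f'_grid j_def)
    moreover have "realizes h (v @ [x]) f'"
      unfolding realizes_def
    proof (intro allI impI)
      fix u e' u' assume eq: "v @ [x] = u @ (1, e') # u'"
      show "if e' then f' (node h u) = node h (u @ [(1, e')])
          else f' (node h (u @ [(1, e')])) = node h u"
      proof (cases "u' = []")
        case True
        then have [simp]: "u = v" "e' = e" "x = (1, e)" using eq x by auto
        show ?thesis
          using f_fix[of "int k" "Suc j"] z_v z_inv_v node_v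
          by (cases e) (simp_all add: f'_grid j_def)
      next
        case False
        then have v_eq: "v = u @ (1, e') # butlast u'"
          using arg_cong[OF eq, of butlast] by (simp add: butlast_append)
        define k' where "k' = h + height u"
        define j' where "j' = b_count u"
        have nodes: "node h u = grid k' j'" "node h (u @ [(1, e')]) = grid k' (Suc j')"
          by (simp_all add: node_def k'_def j'_def)
        have k': "0 \<le> k'"
          using abs_height_le[of u] snoc.prems(3) v_eq by (simp add: k'_def)
        have old: "if e' then f (grid k' j') = grid k' (Suc j') else f (grid k' (Suc j')) = grid k' j'"
          using f(2) v_eq unfolding realizes_def nodes[symmetric] by blast
        have j': "Suc j' \<le> j" using v_eq by (simp add: j_def j'_def)
        \<comment> \<open>Only in this case can \<open>z\<close> move a point at which \<open>f\<close> already has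
          a prescribed value, or that value.\<close>
        have same_sign: "e' = e" if "k' = int k" "Suc j' = j"
        proof -
          have "reduced (butlast u')" "butlast u' \<in> words 2"
            using v v_eq reduced_append[of "u @ [(1, e')]" "butlast u'"] by simp_all
          moreover have "height (butlast u') = 0" "b_count (butlast u') = 0"
            using that v_eq k by (simp_all add: k'_def j'_def j_def)
          ultimately have "butlast u' = []" by (intro height_zero_imp_Nil)
          then have "v @ [x] = u @ [(1, e'), (1, e)]" using v_eq x \<open>i = 1\<close> by simp
          then have "reduced [(1, e'), (1, e)]"
            using snoc.prems(2) reduced_append[of u "[(1, e'), (1, e)]"] by simp
          then show ?thesis by (simp add: reduced_Cons)
        qed
        have zj: "z (grid k' j') = grid k' j'" "(inv\<^bsub>thompson_F\<^esub> z) (grid k' j') = grid k' j'"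
          using j' k' by (auto intro!: z_fix z_inv_fix)
        have zSj: "z (grid k' (Suc j')) = grid k' (Suc j')"
          "(inv\<^bsub>thompson_F\<^esub> z) (grid k' (Suc j')) = grid k' (Suc j')" if "e' \<noteq> e"
          using j' k' that same_sign by (auto intro!: z_fix z_inv_fix)
        show ?thesis
          unfolding nodes using old zj zSj k' by (auto simp: f'_grid)
      qed
    qed
    ultimately show ?thesis
      using True x by (intro exI[of _ f'] exI[of _ "max q (k + 5 + j)"]) (auto simp: j_def)
  qed
qed


section \<open>Markings converging to the free group\<close>

text \<open>
  The other factors of \<open>b\<close> fix every node on the path, so the path of the long word under the
  marking is the one realized by \<open>f\<close>; each short word labels a piece of it and moves the start
  of that piece.
\<close>

lemma ex_marking_without_short_relations:
  "\<exists>b. is_marked_group 2 (thompson_F, [thompson_gen 0, b]) \<and>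
     (\<forall>w\<in>words 2. reduced w \<and> length w \<le> R \<and> w \<noteq> [] \<longrightarrow>
        word_val thompson_F [thompson_gen 0, b] w \<noteq> \<one>\<^bsub>thompson_F\<^esub>)"
proof -
  define W where "W = {w \<in> words 2. reduced w \<and> length w \<le> R}"
  have "W \<subseteq> {w. set w \<subseteq> {..<2} \<times> UNIV \<and> length w \<le> R}"
    by (auto simp: W_def words_def lists_eq_set)
  then have "finite W"
    by (rule finite_subset) (intro finite_lists_length_le finite_cartesian_product, auto)
  then obtain v where v: "v \<in> words 2" "reduced v" and W: "\<And>w. w \<in> W \<Longrightarrow> \<exists>u u'. v = u @ w @ u'"
    using ex_common_superword[of W] unfolding W_def by blast
  define h where "h = int (length v) + 5"
  obtain f q where f: "f \<in> F.bump_group 5 q" "realizes h v f"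
    using ex_realizing_element[OF v, of 5 h] unfolding h_def by auto
  \<comment> \<open>The path must run above \<open>4\<close>, where \<open>double_bump 1\<close> is trivial,
    and below \<open>n\<close>, where \<open>double_bump n\<close> and the tail are trivial;
    it stays within \<open>length v\<close> of \<open>h\<close>.\<close>
  define n where "n = q + 2 * length v + 6"
  have f_bump_group: "f \<in> F.bump_group 5 n" by (rule F.bump_group_mono[OF f(1)]) (simp_all add: n_def)
  have [simp]: "f \<in> carrier thompson_F" using f_bump_group F.bump_group_closed by blast
  define b where "b = F.double_bump 1 \<otimes>\<^bsub>thompson_F\<^esub> f \<otimes>\<^bsub>thompson_F\<^esub> F.double_bump n \<otimes>\<^bsub>thompson_F\<^esub> thompson_gen (2 * n + 5)"
  let ?S = "[thompson_gen 0, b]"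
  have [simp]: "b \<in> carrier thompson_F" by (simp add: b_def)
  have marked: "is_marked_group 2 (thompson_F, ?S)"
  proof -
    have "range thompson_gen \<subseteq> generate thompson_F {thompson_gen 0, b}"
      unfolding b_def using F.generating_pair[OF f_bump_group] by (auto simp: n_def)
    then have "carrier thompson_F \<subseteq> generate thompson_F {thompson_gen 0, b}"
      unfolding generate_thompson_gen[symmetric]
      by (rule F.generate_subgroup_incl) (rule F.generate_is_subgroup, simp)
    moreover have "generate thompson_F {thompson_gen 0, b} \<subseteq> carrier thompson_F"
      by (rule F.generate_incl) simp
    ultimately have "generate thompson_F {thompson_gen 0, b} = carrier thompson_F" by (rule equalityI[rotated])
    then show ?thesis by (simp add: is_marked_group_def)
  qed
  have node_bounds: "5 < node h u" "node h u < real n" if "v = u @ u'" for u u'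
  proof -
    have "5 \<le> h + height u" "h + height u + 1 \<le> int n"
      using abs_height_le[of u] that by (auto simp: h_def n_def)
    then show "5 < node h u" "node h u < real n"
      unfolding node_def
      using grid_bounds[of "h + height u" "b_count u"] by linarith+
  qed
  have b_apply: "b s = t" if "5 < s" "5 < t" "t < real n" "f s = t" for s t
    using that by (simp add: b_def F_mult_apply double_bump_fixes thompson_gen_apply)
  have letter: "letter_val thompson_F ?S x (node h u) = node h (u @ [x])"
    if vx: "v = u @ x # u'" for u x u'
  proof -
    obtain i e where x: "x = (i, e)" by (cases x)
    have i: "i = 0 \<or> i = 1" using v(1) vx x by auto
    have bounds: "5 < node h u" "node h u < real n" "5 < node h (u @ [x])" "node h (u @ [x]) < real n"
      using node_bounds[of u "x # u'"] node_bounds[of "u @ [x]" u'] vx by auto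
    show ?thesis
    proof (cases "i = 0")
      case True
      have "node h (u @ [x]) = node h u + (if e then 1 else - 1)"
        using True x by (simp add: node_def grid_def)
      then show ?thesis
        using True x bounds by (auto simp: thompson_gen_apply intro!: F_inv_apply)
    next
      case False
      with i x have x: "x = (1, e)" by simp
      have "if e then f (node h u) = node h (u @ [x]) else f (node h (u @ [x])) = node h u"
        using f(2) vx unfolding realizes_def x by blast
      then have "if e then b (node h u) = node h (u @ [x]) else b (node h (u @ [x])) = node h u"
        using b_apply bounds by auto
      then show ?thesis
        using bounds by (cases e) (auto simp: x intro!: F_inv_apply)
    qed
  qed
  have path: "word_val thompson_F ?S w (node h u) = node h (u @ w)" if "v = u @ w @ u'" for u w u'
    using that
  proof (induction w arbitrary: u)
    case Nil
    then show ?case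
      using node_bounds[of u u'] by (simp add: word_val_Nil[OF marked] F_one_apply)
  next
    case (Cons x w)
    have "word_val thompson_F ?S (x # w) (node h u) =
        word_val thompson_F ?S w (letter_val thompson_F ?S x (node h u))"
      using node_bounds[of u "x # w @ u'"] Cons.prems
      by (simp add: word_val_Cons[OF marked] F_mult_apply)
    also have "\<dots> = node h ((u @ [x]) @ w)"
      using letter[of u x "w @ u'"] Cons.IH[of "u @ [x]"] Cons.prems by simp
    finally show ?case by simp
  qed
  have "word_val thompson_F ?S w \<noteq> \<one>\<^bsub>thompson_F\<^esub>"
    if w: "w \<in> words 2" "reduced w" "length w \<le> R" "w \<noteq> []" for w
  proof
    assume one: "word_val thompson_F ?S w = \<one>\<^bsub>thompson_F\<^esub>"
    obtain u u' where vu: "v = u @ w @ u'" using W[of w] w by (auto simp: W_def)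
    have "node h (u @ w) = node h u"
      using path[OF vu] node_bounds[OF vu] by (simp add: one F_one_apply)
    then have "height w = 0" "b_count w = 0" by (auto simp: node_def grid_inj)
    then show False using height_zero_imp_Nil w by blast
  qed
  with marked show ?thesis by blast
qed

lemma free_group_letter_mult: "[x] \<otimes>\<^bsub>free_group k\<^esub> w = push x w"
  by (simp add: free_group_def)

lemma push_eq_Cons: "reduced (x # w) \<Longrightarrow> push x w = x # w"
  by (cases w) (auto simp: reduced_Cons)

lemma free_group_inv_letter:
  assumes "i < k"
  shows "inv\<^bsub>free_group k\<^esub> [(i, True)] = [(i, False)]"
proof -
  interpret group "free_group k" by (rule group_free_group)
  show ?thesis
    by (rule inv_equality) (use assms in \<open>auto simp: free_group_def reduced_Cons\<close>)
qed

lemma marked_free_group: "is_marked_group 2 (free_group 2, [[(0, True)], [(1, True)]])"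
proof -
  let ?S = "{[(0, True)], [(1, True)]} :: word set"
  interpret group "free_group 2" by (rule group_free_group)
  have S: "?S \<subseteq> carrier (free_group 2)"
    by (auto simp: free_group_def reduced_Cons)
  have letter: "[x] \<in> generate (free_group 2) ?S" if "fst x < 2" for x
  proof -
    obtain i e where x: "x = (i, e)" by (cases x)
    have i: "i = 0 \<or> i = 1" using that x by auto
    then have g: "[(i, True)] \<in> ?S" by auto
    show ?thesis
      using generate.incl[OF g, of "free_group 2"] generate.inv[OF g, of "free_group 2"] i x
      by (cases e) (auto simp: free_group_inv_letter)
  qed
  have "w \<in> generate (free_group 2) ?S" if "w \<in> words 2" "reduced w" for w
    using that
  proof (induction w)
    case Nil
    have "\<one>\<^bsub>free_group 2\<^esub> \<in> generate (free_group 2) ?S" by (rule generate.one)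
    then show ?case by (simp add: free_group_def)
  next
    case (Cons x w)
    then have "w \<in> generate (free_group 2) ?S" by (simp add: reduced_Cons)
    from generate.eng[OF letter this, of x] show ?case
      using Cons.prems by (simp add: free_group_letter_mult push_eq_Cons)
  qed
  then have "carrier (free_group 2) \<subseteq> generate (free_group 2) ?S"
    by (auto simp: free_group_def)
  then show ?thesis
    using S generate_incl[OF S] by (auto simp: is_marked_group_def group_free_group)
qed

lemma word_val_free_group:
  "w \<in> words 2 \<Longrightarrow> reduced w \<Longrightarrow> word_val (free_group 2) [[(0, True)], [(1, True)]] w = w"
proof (induction w)
  case Nil
  then show ?case by (simp add: word_val_def free_group_def)
next
  case (Cons x w)
  obtain i e where x: "x = (i, e)" by (cases x)
  have "i = 0 \<or> i = 1" using Cons.prems x by auto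
  then have "letter_val (free_group 2) [[(0, True)], [(1, True)]] x = [x]"
    using x by (auto simp: free_group_inv_letter)
  moreover have "word_val (free_group 2) [[(0, True)], [(1, True)]] w = w"
    using Cons by (simp add: reduced_Cons)
  ultimately show ?case
    unfolding word_val_Cons[OF marked_free_group]
    using Cons.prems(2) by (simp only: free_group_letter_mult push_eq_Cons)
qed

lemma relations_free_group: "relations 2 (free_group 2, [[(0, True)], [(1, True)]]) = {[]}"
proof -
  have "\<one>\<^bsub>free_group 2\<^esub> = []" by (simp add: free_group_def)
  then show ?thesis
    using word_val_free_group by (fastforce simp: relations_def)
qed

theorem theorem1:
  shows "\<exists>(a :: nat \<Rightarrow> real \<Rightarrow> real) (b :: nat \<Rightarrow> real \<Rightarrow> real) (L :: word monoid) (c :: word) (d :: word).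
           (\<forall>n\<ge>1. is_marked_group 2 (thompson_F, [a n, b n])) \<and>
           free_of_rank 2 L \<and> is_marked_group 2 (L, [c, d]) \<and>
           limitin (marked_topology 2) (\<lambda>n. marked_class 2 (thompson_F, [a n, b n]))
             (marked_class 2 (L, [c, d])) sequentially"
proof -
  obtain b where b: "\<And>n. is_marked_group 2 (thompson_F, [thompson_gen 0, b n])"
    "\<And>n w. w \<in> words 2 \<Longrightarrow> reduced w \<Longrightarrow> length w \<le> n \<Longrightarrow> w \<noteq> [] \<Longrightarrow>
       word_val thompson_F [thompson_gen 0, b n] w \<noteq> \<one>\<^bsub>thompson_F\<^esub>"
    using ex_marking_without_short_relations by metis
  let ?L = "(free_group 2, [[(0, True)], [(1, True)]])"
  have "same_relations_upto 2 R (thompson_F, [thompson_gen 0, b n]) ?L" if "R \<le> real n" for R n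
  proof -
    have "w = []" if "w \<in> relations 2 (thompson_F, [thompson_gen 0, b n])" "real (length w) \<le> R" for w
      using that b(2)[of w n] \<open>R \<le> real n\<close> by (force simp: relations_def)
    moreover have "[] \<in> relations 2 (thompson_F, [thompson_gen 0, b n])"
      by (simp add: relations_def word_val_Nil[OF b(1)])
    ultimately show ?thesis
      unfolding same_relations_upto_def relations_free_group by auto
  qed
  then have "\<exists>N. \<forall>n\<ge>N. same_relations_upto 2 R (thompson_F, [thompson_gen 0, b n]) ?L" for R
    by (intro exI[of _ "nat \<lceil>R\<rceil>"]) (auto simp: nat_le_iff ceiling_le_iff)
  then have "limitin (marked_topology 2) (\<lambda>n. marked_class 2 (thompson_F, [thompson_gen 0, b n]))
      (marked_class 2 ?L) sequentially"
    by (subst limitin_marked_topology_iff[OF marked_free_group]) (auto simp: b(1))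
  then have "(\<forall>n\<ge>1. is_marked_group 2 (thompson_F, [thompson_gen 0, b n])) \<and>
      free_of_rank 2 (free_group 2) \<and> is_marked_group 2 ?L \<and>
      limitin (marked_topology 2) (\<lambda>n. marked_class 2 (thompson_F, [thompson_gen 0, b n]))
        (marked_class 2 ?L) sequentially"
    by (intro conjI allI impI b(1) free_of_rank_free_group marked_free_group)
  then show ?thesis by (intro exI)
qed

end
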